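(* Let $n\ge1$ and $\pi=\pi_1\cdots\pi_n\in S_n$. Let $S$ be a set of nonnegative integers with $0\in S$. Let $D_S(r)$ denote the number of (unlabeled) $S$-trees with $r$ vertices. The number of decreasing $S$-trees (on $[n]$) with postorder $\pi$ is \[\sum_{\mathscr H\in\mathcal H_S(\pi)}\ \prod_{t=0}^{|\mathscr H|}D_S(q_t(\mathscr H)).\]
   Context: Notation: $[m]=\{1,\ldots,m\}$; permutations in $S_n$ are written as words $\pi_1\cdots\pi_n$. A descent of $\pi$ is an index $i\in[n-1]$ with $\pi_i>\pi_{i+1}$. Trees. For a set $S$ of nonnegative integers with $0\in S$, an $S$-tree is a (nonempty, finite) rooted plane tree consisting of a root together with a $j$-tuple (ordered left to right) of $S$-trees for some $j\in S$. A decreasing $S$-tree on a finite set $X$ of positive integers is an $S$-tree whose vertices are labeled bijectively by the elements of $X$ so that each nonroot vertex has a smaller label than its parent. The postorder of a tree is the word obtained by recursively reading the subtrees of the root in postorder from left to right and then reading the root. Valid hook configurations. The diagram of $\pi$ consists of the points $(i,\pi_i)$, $i\in[n]$. A hook $H$ is determined by indices $i<j$ with $\pi_i<\pi_j$: it is the union of the vertical segment from $(i,\pi_i)$ to $(i,\pi_j)$ and the horizontal segment from $(i,\pi_j)$ to $(j,\pi_j)$. Its southwest endpoint is ${}_eH=(i,\pi_i)$ and its northeast endpoint is $H^e=(j,\pi_j)$. A valid hook configuration of $\pi$ is an $m$-tuple $\mathscr H=(H_1,\ldots,H_m)$ ($m\ge 0$) of hooks in the diagram of $\pi$ such that: (a)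 if ${}_eH_\ell=(i_\ell,\pi_{i_\ell})$ for each $\ell\in[m]$, then $i_1<i_2<\cdots<i_m$; (b) if $i$ is a descent of $\pi$, then $(i,\pi_i)={}_eH_\ell$ for some $\ell\in[m]$; (c) if $(j,\pi_j)=H_\ell^e$ for some $\ell\in[m]$, then there exist $\ell',\ell''\in[m]$ such that the $x$-coordinate of ${}_eH_{\ell'}$ is a descent of $\pi$, $(j-1,\pi_{j-1})={}_eH_{\ell''}$, and $H_{\ell'}^e=H_{\ell''}^e=(j,\pi_j)$; (d) if $\ell,\ell'\in[m]$, ${}_eH_\ell=(i,\pi_i)$, $H_\ell^e=(j,\pi_j)$, ${}_eH_{\ell'}=(i',\pi_{i'})$, $H_{\ell'}^e=(j',\pi_{j'})$, $\pi_j<\pi_{j'}$, and the real intervals $[i,j]$ and $[i',j']$ have more than one point in common, then $[i,j]\subseteq[i',j']$. The identity permutation has exactly one valid hook configuration, the empty one. Write $\mathcal H(\pi)$ for the set of valid hook configurations of $\pi$, $|\mathscr H|=m$ for the number of hooks, and $NE(\mathscr H)=\{H_1^e,\ldots,H_m^e\}$. For $j\in[n]$, $w_j(\mathscr H)$ is the number of hooks in $\mathscr H$ with northeast endpoint $(j,\pi_j)$, and $\mathcal H_S(\pi)=\{\mathscr H\in\mathcal H(\pi): w_j(\mathscr H)\in S\text{ for all }j\in[n]\}$. Coloring. Given $\mathscr H=(H_1,\ldots,H_m)\in\mathcal H(\pi)$, color the points of the diagram with colors $c_0,\ldots,c_m$. The hook $H_\ell$ has color $c_\ell$; if ${}_eH_\ell=(i,\pi_i)$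 and $H_\ell^e=(j,\pi_j)$, its top part is the segment from $(i+1/2,\pi_j)$ to $(j,\pi_j)$. If $(k,\pi_k)\in NE(\mathscr H)$, give $(k,\pi_k)$ the color $c_r$ where $r$ is the largest index with $H_r^e=(k,\pi_k)$. Otherwise move directly upward from $(k,\pi_k)$ until first hitting the top part of a hook, and give $(k,\pi_k)$ the color of that hook; if several hooks are hit simultaneously, use the one whose southwest endpoint is farthest to the right; if no top part is hit, use $c_0$. Let $q_t(\mathscr H)$ be the number of points $(\ell,\pi_\ell)$ of color $c_t$. *)

theory Defs
  imports Complex_Main "HOL-Combinatorics.Permutations"
begin

datatype 'a plane_tree = Node (label: 'a) "'a plane_tree list"

fun S_tree :: "nat set \<Rightarrow> 'a plane_tree \<Rightarrow> bool" where
  "S_tree S (Node a ts) \<longleftrightarrow> length ts \<in> S \<and> (\<forall>t\<in>set ts. S_tree S t)"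

fun num_vertices :: "'a plane_tree \<Rightarrow> nat" where
  "num_vertices (Node a ts) = 1 + (\<Sum>t\<leftarrow>ts. num_vertices t)"

fun postorder :: "'a plane_tree \<Rightarrow> 'a list" where
  "postorder (Node a ts) = concat (map postorder ts) @ [a]"

fun decreasing :: "nat plane_tree \<Rightarrow> bool" where
  "decreasing (Node a ts) \<longleftrightarrow> (\<forall>t\<in>set ts. label t < a \<and> decreasing t)"

text \<open>The postorder lists the label of every vertex exactly once, so the last two conjuncts say
  that the vertices are labeled bijectively by the elements of \<open>X\<close>.\<close>

definition decreasing_S_tree :: "nat set \<Rightarrow> nat set \<Rightarrow> nat plane_tree \<Rightarrow> bool" where
  "decreasing_S_tree S X t \<longleftrightarrow>
     S_tree S t \<and> decreasing t \<and> distinct (postorder t) \<and> set (postorder t) = X"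

text \<open>Unlabeled trees are trees all of whose labels are \<open>()\<close>.\<close>

definition D :: "nat set \<Rightarrow> nat \<Rightarrow> nat" where
  "D S r = card {t :: unit plane_tree. S_tree S t \<and> num_vertices t = r}"

definition descent :: "nat \<Rightarrow> (nat \<Rightarrow> nat) \<Rightarrow> nat \<Rightarrow> bool" where
  "descent n \<pi> i \<longleftrightarrow> i \<in> {1..n - 1} \<and> \<pi> i > \<pi> (i + 1)"

text \<open>A hook is represented by the pair \<open>(i, j)\<close> of \<open>x\<close>-coordinates of its southwest endpoint
  \<open>(i, \<pi> i)\<close> and its northeast endpoint \<open>(j, \<pi> j)\<close>. Points of the diagram are likewise
  represented by their \<open>x\<close>-coordinates.\<close>

type_synonym hook = "nat \<times> nat"

abbreviation sw :: "hook \<Rightarrow> nat" where "sw \<equiv> fst"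
abbreviation ne :: "hook \<Rightarrow> nat" where "ne \<equiv> snd"

definition is_hook :: "nat \<Rightarrow> (nat \<Rightarrow> nat) \<Rightarrow> hook \<Rightarrow> bool" where
  "is_hook n \<pi> h \<longleftrightarrow>
     sw h \<in> {1..n} \<and> ne h \<in> {1..n} \<and> sw h < ne h \<and> \<pi> (sw h) < \<pi> (ne h)"

definition hook_interval :: "hook \<Rightarrow> real set" where
  "hook_interval h = {real (sw h)..real (ne h)}"

definition valid_hook_config :: "nat \<Rightarrow> (nat \<Rightarrow> nat) \<Rightarrow> hook list \<Rightarrow> bool" where
  "valid_hook_config n \<pi> H \<longleftrightarrow>
     (\<forall>h\<in>set H. is_hook n \<pi> h) \<and>
     sorted_wrt (\<lambda>h h'. sw h < sw h') H \<and>
     (\<forall>i. descent n \<pi> i \<longrightarrow> (\<exists>h\<in>set H. sw h = i)) \<and>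
     (\<forall>h\<in>set H. \<exists>h'\<in>set H. \<exists>h''\<in>set H.
        descent n \<pi> (sw h') \<and> sw h'' = ne h - 1 \<and> ne h' = ne h \<and> ne h'' = ne h) \<and>
     (\<forall>h\<in>set H. \<forall>h'\<in>set H.
        \<pi> (ne h) < \<pi> (ne h') \<and>
        (\<exists>x y. x \<noteq> y \<and> {x, y} \<subseteq> hook_interval h \<inter> hook_interval h') \<longrightarrow>
        hook_interval h \<subseteq> hook_interval h')"

text \<open>The hooks of \<open>H = (H\<^sub>1, \<dots>, H\<^sub>m)\<close> are numbered from 1, whereas list positions start at 0.\<close>

abbreviation nth_hook :: "hook list \<Rightarrow> nat \<Rightarrow> hook" where
  "nth_hook H l \<equiv> H ! (l - 1)"

definition w :: "hook list \<Rightarrow> nat \<Rightarrow> nat" where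
  "w H j = card {l \<in> {1..length H}. ne (nth_hook H l) = j}"

definition valid_hook_configs :: "nat set \<Rightarrow> nat \<Rightarrow> (nat \<Rightarrow> nat) \<Rightarrow> hook list set" where
  "valid_hook_configs S n \<pi> = {H. valid_hook_config n \<pi> H \<and> (\<forall>j\<in>{1..n}. w H j \<in> S)}"

text \<open>The hooks whose top part, the segment from \<open>(i + 1/2, \<pi> j)\<close> to \<open>(j, \<pi> j)\<close>, meets the
  vertical ray going up from \<open>(k, \<pi> k)\<close>; \<open>first_hit\<close> selects those among them that are met at
  the lowest height.\<close>

definition hit :: "(nat \<Rightarrow> nat) \<Rightarrow> hook list \<Rightarrow> nat \<Rightarrow> nat set" where
  "hit \<pi> H k = {l \<in> {1..length H}.
     real k \<in> {real (sw (nth_hook H l)) + 1/2..real (ne (nth_hook H l))} \<and>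
     \<pi> k \<le> \<pi> (ne (nth_hook H l))}"

definition first_hit :: "(nat \<Rightarrow> nat) \<Rightarrow> hook list \<Rightarrow> nat \<Rightarrow> nat set" where
  "first_hit \<pi> H k =
     {l \<in> hit \<pi> H k. \<forall>l'\<in>hit \<pi> H k. \<pi> (ne (nth_hook H l)) \<le> \<pi> (ne (nth_hook H l'))}"

text \<open>The color \<open>c\<^sub>t\<close> is represented by its index \<open>t\<close>.\<close>

definition color :: "(nat \<Rightarrow> nat) \<Rightarrow> hook list \<Rightarrow> nat \<Rightarrow> nat" where
  "color \<pi> H k =
     (if \<exists>h\<in>set H. ne h = k then Max {r \<in> {1..length H}. ne (nth_hook H r) = k}
      else if hit \<pi> H k = {} then 0
      else ARG_MAX (\<lambda>l. sw (nth_hook H l)) l. l \<in> first_hit \<pi> H k)"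

definition q :: "nat \<Rightarrow> (nat \<Rightarrow> nat) \<Rightarrow> hook list \<Rightarrow> nat \<Rightarrow> nat" where
  "q n \<pi> H t = card {l \<in> {1..n}. color \<pi> H l = t}"

end

theory Submission
  imports Defs
begin

text \<open>
  Both sides are computed by the same recursion on the intervals \<open>[a, b)\<close> of positions. A
  decreasing tree on \<open>[a, b + 1)\<close> has its root at \<open>b\<close>, and its \<open>k\<close> subtrees cut \<open>[a, b)\<close> into
  consecutive blocks. If some cut is at a descent, this matches the configurations with \<open>k\<close>
  hooks ending at \<open>b\<close>, one from the last point of each block; no other hook crosses a cut. If all
  cuts are at ascents, it matches the configurations without a hook ending at \<open>b\<close>: the points of
  color \<open>c\<^sub>0\<close> are exactly the positions in front of which no hook is crossed, so the recursion
  \<open>D (m + 1) = (\<Sum>k\<in>S. number of forests of k trees with m vertices)\<close> distributes the points of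
  color \<open>c\<^sub>0\<close> over the blocks.

  Hooks above a common point are nested, so a point has the color of the hook above it that
  starts last. Hence the points colored by a hook \<open>(i, j)\<close> are those of \<open>[i + 1, j + 1)\<close> which are
  uncovered by the hooks starting in that interval, just as the points of color \<open>c\<^sub>0\<close> are those of
  the whole interval which are uncovered by all hooks.
\<close>

section \<open>Trees and forests\<close>

lemma length_postorder: "length (postorder t) = num_vertices t"
  by (induction t) (simp add: length_concat comp_def cong: map_cong)

lemma num_vertices_pos: "num_vertices t > 0"
  by (cases t) simp

lemma num_vertices_neq_0 [simp]: "num_vertices t \<noteq> 0"
  by (cases t) simp

lemma length_le_sum_num_vertices: "length ts \<le> (\<Sum>t\<leftarrow>ts. num_vertices t)"
proof (induction ts)
  case (Cons t ts)
  then show ?case using num_vertices_pos[of t] by simp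
qed simp

lemma label_in_postorder: "label t \<in> set (postorder t)"
  by (cases t) simp

lemma decreasing_postorder_le:
  "decreasing t \<Longrightarrow> x \<in> set (postorder t) \<Longrightarrow> x \<le> label t"
proof (induction t)
  case (Node a ts)
  then show ?case by fastforce
qed

text \<open>Cardinalities of infinite sets default to 0, so finiteness has to come first. Every tree
  has a vertex, hence a tree with at most \<open>n + 1\<close> vertices is a root label with a list
  of at most \<open>n\<close> trees of at most \<open>n\<close> vertices each.\<close>

lemma finite_plane_trees:
  assumes "finite A"
  shows "finite {t. set (postorder t) \<subseteq> A \<and> num_vertices t \<le> n}"
proof (induction n)
  case 0
  have "{t. set (postorder t) \<subseteq> A \<and> num_vertices t \<le> 0} = {}"
    by simp
  then show ?case by (simp only: finite.emptyI)
next
  case (Suc n)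
  let ?B = "{t. set (postorder t) \<subseteq> A \<and> num_vertices t \<le> n}"
  let ?L = "{ts. set ts \<subseteq> ?B \<and> length ts \<le> n}"
  have "{t. set (postorder t) \<subseteq> A \<and> num_vertices t \<le> Suc n} \<subseteq> case_prod Node ` (A \<times> ?L)"
  proof
    fix t assume t: "t \<in> {t. set (postorder t) \<subseteq> A \<and> num_vertices t \<le> Suc n}"
    obtain a ts where [simp]: "t = Node a ts" by (cases t)
    have *: "(\<Sum>t\<leftarrow>ts. num_vertices t) \<le> n" using t by simp
    have "num_vertices s \<le> n" if "s \<in> set ts" for s
      using * member_le_sum_list[of "num_vertices s" "map num_vertices ts"] that by force
    moreover have "set (postorder s) \<subseteq> A" if "s \<in> set ts" for s
      using t that by auto
    ultimately have "ts \<in> ?L"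
      using length_le_sum_num_vertices[of ts] * by auto
    then show "t \<in> case_prod Node ` (A \<times> ?L)" using t by auto
  qed
  then show ?case
    using assms finite_lists_length_le[OF Suc] by (meson finite_SigmaI finite_imageI finite_subset)
qed

lemma finite_unit_trees: "finite {t :: unit plane_tree. S_tree S t \<and> num_vertices t = r}"
  by (rule finite_subset[OF _ finite_plane_trees[of "UNIV :: unit set" r]]) auto

lemma finite_trees_postorder: "finite {t. postorder t = xs}"
  by (rule finite_subset[OF _ finite_plane_trees[of "set xs" "length xs"]])
     (auto simp flip: length_postorder)

lemma D_0: "D S 0 = 0"
proof -
  have "{t :: unit plane_tree. S_tree S t \<and> num_vertices t = 0} = {}"
    by simp
  then show ?thesis by (simp add: D_def)
qed

section \<open>Recursion for unlabeled trees and forests\<close>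

definition unit_forests :: "nat set \<Rightarrow> nat \<Rightarrow> nat \<Rightarrow> unit plane_tree list set" where
  "unit_forests S k m =
     {ts. length ts = k \<and> (\<forall>t\<in>set ts. S_tree S t) \<and> (\<Sum>t\<leftarrow>ts. num_vertices t) = m}"

lemma finite_unit_forests: "finite (unit_forests S k m)"
proof -
  let ?B = "\<Union>r\<le>m. {t :: unit plane_tree. S_tree S t \<and> num_vertices t = r}"
  have "num_vertices t \<le> m" if "ts \<in> unit_forests S k m" "t \<in> set ts" for t ts
    using that member_le_sum_list[of "num_vertices t" "map num_vertices ts"]
    by (auto simp: unit_forests_def)
  then have "unit_forests S k m \<subseteq> {ts. set ts \<subseteq> ?B \<and> length ts \<le> k}"
    by (auto simp: unit_forests_def)
  moreover have "finite {ts. set ts \<subseteq> ?B \<and> length ts \<le> k}"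
    by (rule finite_lists_length_le) (use finite_unit_trees in blast)
  ultimately show ?thesis by (rule finite_subset)
qed

lemma card_unit_forests_0: "card (unit_forests S 0 m) = of_bool (m = 0)"
proof -
  have "unit_forests S 0 m = (if m = 0 then {[]} else {})"
    by (auto simp: unit_forests_def)
  then show ?thesis by simp
qed

text \<open>Splitting off the first tree gives a convolution. The term \<open>j = 0\<close> vanishes
  by \<open>D_0\<close>; the range \<open>j \<le> m\<close> is the one that
  \<open>sum_over_cuts\<close> produces.\<close>

lemma card_unit_forests_Suc:
  "card (unit_forests S (Suc k) m) = (\<Sum>j\<le>m. D S j * card (unit_forests S k (m - j)))"
proof -
  let ?T = "\<lambda>j. {t :: unit plane_tree. S_tree S t \<and> num_vertices t = j}"
  have "bij_betw (\<lambda>(j, t, ts). t # ts) (SIGMA j:{..m}. ?T j \<times> unit_forests S k (m - j))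
          (unit_forests S (Suc k) m)"
    by (rule bij_betw_byWitness[where f' = "\<lambda>ts. (num_vertices (hd ts), hd ts, tl ts)"])
       (auto simp: unit_forests_def length_Suc_conv)
  then have "card (unit_forests S (Suc k) m)
      = card (SIGMA j:{..m}. ?T j \<times> unit_forests S k (m - j))"
    by (simp add: bij_betw_same_card)
  also have "\<dots> = (\<Sum>j\<le>m. D S j * card (unit_forests S k (m - j)))"
    by (subst card_SigmaI)
       (auto simp: finite_unit_trees finite_unit_forests card_cartesian_product D_def)
  finally show ?thesis .
qed

text \<open>Removing the root leaves a forest. Each tree has a vertex, so at most \<open>m\<close>
  trees occur and every bound \<open>N \<ge> m\<close> gives the same sum. This allows one common
  bound for configurations with different numbers of points of color 0.\<close>

lemma D_Suc:
  assumes "m \<le> N"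
  shows "D S (Suc m) = (\<Sum>k\<in>S \<inter> {..N}. card (unit_forests S k m))"
proof -
  have "{t :: unit plane_tree. S_tree S t \<and> num_vertices t = Suc m}
      = Node () ` (\<Union>k\<in>S \<inter> {..N}. unit_forests S k m)" (is "?L = ?R")
  proof
    show "?L \<subseteq> ?R"
    proof
      fix t assume t: "t \<in> ?L"
      obtain a ts where "t = Node a ts" by (cases t)
      then have "t = Node () ts" by simp
      moreover have "length ts \<in> S \<inter> {..N}" "ts \<in> unit_forests S (length ts) m"
        using t assms length_le_sum_num_vertices[of ts] \<open>t = Node () ts\<close>
        by (auto simp: unit_forests_def)
      ultimately show "t \<in> ?R" by blast
    qed
  qed (auto simp: unit_forests_def)
  then have "D S (Suc m) = card (\<Union>k\<in>S \<inter> {..N}. unit_forests S k m)"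
    by (simp add: D_def card_image inj_on_def)
  also have "\<dots> = (\<Sum>k\<in>S \<inter> {..N}. card (unit_forests S k m))"
    by (rule card_UN_disjoint) (auto simp: finite_unit_forests, auto simp: unit_forests_def)
  finally show ?thesis .
qed

lemma D_1: "0 \<in> S \<Longrightarrow> D S (Suc 0) = 1"
  by (simp add: D_Suc[of 0 0] card_unit_forests_0)

section \<open>Decreasing trees and forests on intervals of positions\<close>

locale hook_counting =
  fixes \<pi> :: "nat \<Rightarrow> nat" and S :: "nat set"
  assumes inj: "inj \<pi>" and zero: "0 \<in> S"
begin

definition trees :: "nat \<Rightarrow> nat \<Rightarrow> nat plane_tree set" where
  "trees a b = {t. S_tree S t \<and> decreasing t \<and> postorder t = map \<pi> [a..<b]}"

definition forests :: "nat \<Rightarrow> nat \<Rightarrow> nat \<Rightarrow> nat plane_tree list set" where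
  "forests k a b = {ts. length ts = k \<and> (\<forall>t\<in>set ts. S_tree S t \<and> decreasing t) \<and>
     concat (map postorder ts) = map \<pi> [a..<b]}"

lemma finite_trees: "finite (trees a b)"
  by (rule finite_subset[OF _ finite_trees_postorder[of "map \<pi> [a..<b]"]]) (auto simp: trees_def)

lemma num_vertices_trees: "t \<in> trees a b \<Longrightarrow> num_vertices t = b - a"
  using length_postorder[of t] by (simp add: trees_def)

lemma forests_0: "a \<le> b \<Longrightarrow> forests 0 a b = (if a = b then {[]} else {})"
  by (auto simp: forests_def)

text \<open>The first tree fills a block \<open>[a, c)\<close>. A postorder has one letter per
  vertex, so \<open>c\<close> is recovered as \<open>a\<close> plus the size of that tree, and
  \<open>a < c\<close> because trees are nonempty.\<close>

lemma bij_forests_Suc: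
  assumes "a \<le> b"
  shows "bij_betw (\<lambda>(c, t, ts). t # ts) (SIGMA c:{a<..b}. trees a c \<times> forests k c b)
    (forests (Suc k) a b)"
proof (rule bij_betw_byWitness[where f' = "\<lambda>ts. (a + num_vertices (hd ts), hd ts, tl ts)"])
  show "(\<lambda>(c, t, ts). t # ts) ` (SIGMA c:{a<..b}. trees a c \<times> forests k c b)
      \<subseteq> forests (Suc k) a b"
  proof clarify
    fix c t ts assume *: "c \<in> {a<..b}" "t \<in> trees a c" "ts \<in> forests k c b"
    have "[a..<b] = [a..<c] @ [c..<b]"
      using upt_add_eq_append[of a c "b - c"] * by simp
    then show "t # ts \<in> forests (Suc k) a b"
      using * by (auto simp: trees_def forests_def)
  qed
  show "(\<lambda>ts. (a + num_vertices (hd ts), hd ts, tl ts)) ` forests (Suc k) a b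
      \<subseteq> (SIGMA c:{a<..b}. trees a c \<times> forests k c b)"
  proof (rule image_subsetI)
    fix us assume "us \<in> forests (Suc k) a b"
    then obtain t ts where us: "us = t # ts" "length ts = k"
      "S_tree S t" "decreasing t" "\<forall>t\<in>set ts. S_tree S t \<and> decreasing t"
      "postorder t @ concat (map postorder ts) = map \<pi> [a..<b]"
      by (auto simp: forests_def length_Suc_conv)
    let ?c = "a + num_vertices t"
    from us(6) have "length (postorder t @ concat (map postorder ts)) = b - a" by simp
    then have c: "a < ?c" "?c \<le> b"
      using num_vertices_pos[of t] assms by (auto simp: length_postorder)
    have "[a..<b] = [a..<?c] @ [?c..<b]"
      using upt_add_eq_append[of a ?c "b - ?c"] c by simp
    then have "postorder t @ concat (map postorder ts) = map \<pi> [a..<?c] @ map \<pi> [?c..<b]"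
      using us(6) by simp
    then have "postorder t = map \<pi> [a..<?c]" "concat (map postorder ts) = map \<pi> [?c..<b]"
      by (simp_all add: append_eq_append_conv length_postorder)
    then show "(a + num_vertices (hd us), hd us, tl us)
        \<in> (SIGMA c:{a<..b}. trees a c \<times> forests k c b)"
      using us c by (auto simp: trees_def forests_def)
  qed
  show "\<forall>x\<in>SIGMA c:{a<..b}. trees a c \<times> forests k c b.
      (\<lambda>ts. (a + num_vertices (hd ts), hd ts, tl ts)) ((\<lambda>(c, t, ts). t # ts) x) = x"
    by (auto simp: num_vertices_trees)
  show "\<forall>ts\<in>forests (Suc k) a b.
      (\<lambda>(c, t, ts). t # ts) (a + num_vertices (hd ts), hd ts, tl ts) = ts"
    by (auto simp: forests_def length_Suc_conv)
qed

lemma finite_forests: "a \<le> b \<Longrightarrow> finite (forests k a b)"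
proof (induction k arbitrary: a)
  case 0
  then show ?case by (simp add: forests_0)
next
  case (Suc k)
  have "finite (SIGMA c:{a<..b}. trees a c \<times> forests k c b)"
    using Suc.IH finite_trees by auto
  then show ?case using bij_forests_Suc[OF Suc.prems] bij_betw_finite by blast
qed

text \<open>\<open>splits \<phi> k a b\<close> counts the forests of \<open>k\<close> trees whose cuts, the positions where the
  second and later trees start, all satisfy \<open>\<phi>\<close>.\<close>

fun splits :: "(nat \<Rightarrow> bool) \<Rightarrow> nat \<Rightarrow> nat \<Rightarrow> nat \<Rightarrow> nat" where
  "splits \<phi> 0 a b = of_bool (a = b)"
| "splits \<phi> (Suc k) a b =
     (\<Sum>c\<in>{c\<in>{a<..b}. c = b \<or> \<phi> c}. card (trees a c) * splits \<phi> k c b)"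

lemma card_forests: "a \<le> b \<Longrightarrow> card (forests k a b) = splits (\<lambda>_. True) k a b"
proof (induction k arbitrary: a)
  case 0
  then show ?case by (simp add: forests_0)
next
  case (Suc k)
  have "card (forests (Suc k) a b) = card (SIGMA c:{a<..b}. trees a c \<times> forests k c b)"
    using bij_betw_same_card[OF bij_forests_Suc[OF Suc.prems]] by simp
  also have "\<dots> = (\<Sum>c\<in>{a<..b}. card (trees a c) * card (forests k c b))"
    by (subst card_SigmaI) (auto simp: finite_trees finite_forests card_cartesian_product)
  also have "\<dots> = (\<Sum>c\<in>{a<..b}. card (trees a c) * splits (\<lambda>_. True) k c b)"
    using Suc.IH by (intro sum.cong) auto
  also have "{a<..b} = {c\<in>{a<..b}. c = b \<or> True}" by auto
  finally show ?case by simp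
qed

definition dominant :: "nat \<Rightarrow> nat \<Rightarrow> bool" where
  "dominant a b \<longleftrightarrow> (\<forall>i\<in>{a..<b}. \<pi> i < \<pi> b)"

text \<open>The postorder ends with the root, so the root has label \<open>\<pi> b\<close> and its
  subtrees form a forest on \<open>[a, b)\<close>. Bounding the number of subtrees by
  \<open>b - a\<close> keeps the index set finite.\<close>

lemma trees_Suc:
  assumes "a \<le> b"
  shows "trees a (Suc b) =
    (if dominant a b then Node (\<pi> b) ` (\<Union>k\<in>S \<inter> {..b - a}. forests k a b) else {})"
proof -
  have Node_iff: "Node x ts \<in> trees a (Suc b) \<longleftrightarrow>
      x = \<pi> b \<and> dominant a b \<and> length ts \<in> S \<inter> {..b - a} \<and> ts \<in> forests (length ts) a b" for x ts
  proof (cases "(\<forall>t\<in>set ts. decreasing t) \<and> concat (map postorder ts) = map \<pi> [a..<b]")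
    case True
    then have "length (concat (map postorder ts)) = b - a" by simp
    then have "(\<Sum>t\<leftarrow>ts. num_vertices t) = b - a"
      by (simp add: length_concat comp_def length_postorder)
    then have "length ts \<le> b - a"
      using length_le_sum_num_vertices[of ts] by simp
    \<comment> \<open>The root of a decreasing tree carries its largest label, so testing the
      children of the new root tests all its descendants.\<close>
    moreover have "(\<forall>t\<in>set ts. label t < \<pi> b) \<longleftrightarrow> (\<forall>y\<in>set (concat (map postorder ts)). y < \<pi> b)"
    proof
      assume *: "\<forall>t\<in>set ts. label t < \<pi> b"
      have "y < \<pi> b" if "t \<in> set ts" "y \<in> set (postorder t)" for t y
        using * True that decreasing_postorder_le[of t y] by (meson le_less_trans)
      then show "\<forall>y\<in>set (concat (map postorder ts)). y < \<pi> b" by auto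
    next
      assume "\<forall>y\<in>set (concat (map postorder ts)). y < \<pi> b"
      then show "\<forall>t\<in>set ts. label t < \<pi> b" using label_in_postorder by auto
    qed
    then have "(\<forall>t\<in>set ts. label t < \<pi> b) \<longleftrightarrow> dominant a b"
      using True by (simp add: dominant_def)
    ultimately show ?thesis
      using True assms by (auto simp: trees_def forests_def)
  next
    case False
    then show ?thesis using assms by (auto simp: trees_def forests_def)
  qed
  have "t \<in> trees a (Suc b) \<longleftrightarrow> t \<in> (if dominant a b
      then Node (\<pi> b) ` (\<Union>k\<in>S \<inter> {..b - a}. forests k a b) else {})" for t
  proof (cases t)
    case [simp]: (Node x ts)
    have "ts \<in> forests k a b \<Longrightarrow> k = length ts" for k by (simp add: forests_def)
    then show ?thesis by (auto simp: Node_iff)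
  qed
  then show ?thesis by blast
qed

lemma card_trees_Suc:
  assumes "a \<le> b"
  shows "card (trees a (Suc b)) =
    (if dominant a b then \<Sum>k\<in>S \<inter> {..b - a}. splits (\<lambda>_. True) k a b else 0)"
proof (cases "dominant a b")
  case True
  then have "card (trees a (Suc b)) = card (\<Union>k\<in>S \<inter> {..b - a}. forests k a b)"
    by (simp add: trees_Suc[OF assms] card_image inj_on_def)
  also have "\<dots> = (\<Sum>k\<in>S \<inter> {..b - a}. card (forests k a b))"
    by (rule card_UN_disjoint) (auto simp: finite_forests assms, auto simp: forests_def)
  finally show ?thesis using True by (simp add: card_forests assms)
qed (simp add: trees_Suc assms)

section \<open>Hook configurations on intervals\<close>

text \<open>Condition (d) in integer form: two hooks have more than one abscissa in common exactly
  if each starts before the other ends.\<close>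

definition nested :: "hook set \<Rightarrow> bool" where
  "nested H \<longleftrightarrow> (\<forall>i j i' j'. (i, j) \<in> H \<longrightarrow> (i', j') \<in> H \<longrightarrow> \<pi> j < \<pi> j' \<longrightarrow> i < j' \<longrightarrow> i' < j \<longrightarrow>
     i' \<le> i \<and> j \<le> j')"

definition sources :: "hook set \<Rightarrow> nat \<Rightarrow> nat set" where
  "sources H j = {i. (i, j) \<in> H}"

text \<open>Condition (c) for the hooks ending at \<open>j\<close>, joined with membership of their
  number in \<open>S\<close>. Both depend only on \<open>sources H j\<close>, so they carry over
  whenever gluing or cutting keeps that set.\<close>

definition closed_at :: "hook set \<Rightarrow> nat \<Rightarrow> bool" where
  "closed_at H j \<longleftrightarrow> card (sources H j) \<in> S \<and>
     (sources H j \<noteq> {} \<longrightarrow> j - 1 \<in> sources H j \<and> (\<exists>i\<in>sources H j. \<pi> (Suc i) < \<pi> i))"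

text \<open>Configurations are sets here: the order of the hooks carries no information, and
  condition (a) becomes the clause that each start has only one end. Condition (c) is left to
  \<open>closed_at\<close>.\<close>

definition hooks_on :: "nat \<Rightarrow> nat \<Rightarrow> hook set \<Rightarrow> bool" where
  "hooks_on a b H \<longleftrightarrow>
     (\<forall>i j. (i, j) \<in> H \<longrightarrow> a \<le> i \<and> i < j \<and> j < b \<and> \<pi> i < \<pi> j) \<and>
     (\<forall>i j j'. (i, j) \<in> H \<longrightarrow> (i, j') \<in> H \<longrightarrow> j = j') \<and>
     (\<forall>i. a \<le> i \<longrightarrow> Suc i < b \<longrightarrow> \<pi> (Suc i) < \<pi> i \<longrightarrow> (\<exists>j. (i, j) \<in> H)) \<and>
     nested H"

definition configs :: "nat \<Rightarrow> nat \<Rightarrow> hook set set" where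
  "configs a b = {H. hooks_on a b H \<and> (\<forall>j<b. closed_at H j)}"

text \<open>Configurations on \<open>[a, b]\<close> with \<open>k\<close> hooks ending at \<open>b\<close>, where the conditions on the hooks
  ending at \<open>b\<close> are relaxed so that the first block can be split off: neither \<open>k \<in> S\<close> nor a
  descent among their starting points is required. For \<open>k = 0\<close> this leaves only \<open>a = b\<close>.\<close>

definition partials :: "(nat \<Rightarrow> bool) \<Rightarrow> nat \<Rightarrow> nat \<Rightarrow> nat \<Rightarrow> hook set set" where
  "partials \<phi> k a b = {H. hooks_on a (Suc b) H \<and> (\<forall>j<b. closed_at H j) \<and>
     card (sources H b) = k \<and> (a < b \<longrightarrow> (b - 1, b) \<in> H) \<and>
     (\<forall>i. (i, b) \<in> H \<longrightarrow> Suc i < b \<longrightarrow> \<phi> (Suc i))}"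

lemma hooks_onD:
  assumes "hooks_on a b H" "(i, j) \<in> H"
  shows "a \<le> i" "i < j" "j < b" "\<pi> i < \<pi> j"
  using assms by (auto simp: hooks_on_def)

lemma hooks_on_unique: "hooks_on a b H \<Longrightarrow> (i, j) \<in> H \<Longrightarrow> (i, j') \<in> H \<Longrightarrow> j = j'"
  unfolding hooks_on_def by blast

lemma hooks_on_descent:
  "hooks_on a b H \<Longrightarrow> a \<le> i \<Longrightarrow> Suc i < b \<Longrightarrow> \<pi> (Suc i) < \<pi> i \<Longrightarrow> \<exists>j. (i, j) \<in> H"
  unfolding hooks_on_def by blast

lemma nestedD:
  assumes "nested H" "(i, j) \<in> H" "(i', j') \<in> H" "\<pi> j < \<pi> j'" "i < j'" "i' < j"
  shows "i' \<le> i" "j \<le> j'"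
  using assms unfolding nested_def by blast+

lemma hooks_on_nested: "hooks_on a b H \<Longrightarrow> nested H"
  by (simp add: hooks_on_def)

lemma hooks_on_bound: "hooks_on a b H \<Longrightarrow> (i, j) \<in> H \<Longrightarrow> i < b \<and> j < b"
  using hooks_onD[of a b H i j] by simp

lemma finite_hooks_on: "finite {H. hooks_on a b H}"
proof -
  have "{H. hooks_on a b H} \<subseteq> Pow ({..<b} \<times> {..<b})"
    by (auto dest: hooks_on_bound)
  then show ?thesis by (rule finite_subset) simp
qed

lemma finite_configs: "finite (configs a b)"
  by (rule finite_subset[OF _ finite_hooks_on[of a b]]) (auto simp: configs_def)

lemma finite_partials: "finite (partials \<phi> k a b)"
  by (rule finite_subset[OF _ finite_hooks_on[of a "Suc b"]]) (auto simp: partials_def)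

lemma hooks_on_finite: "hooks_on a b H \<Longrightarrow> finite H"
  by (rule finite_subset[of _ "{..<b} \<times> {..<b}"]) (auto dest: hooks_on_bound)

lemma finite_sources: "hooks_on a b H \<Longrightarrow> finite (sources H j)"
  by (rule finite_subset[of _ "{..<b}"]) (auto simp: sources_def dest: hooks_on_bound)

section \<open>Gluing and cutting configurations at a block boundary\<close>

lemma closed_at_cong: "sources H j = sources H' j \<Longrightarrow> closed_at H j = closed_at H' j"
  by (simp add: closed_at_def)

lemma closed_at_empty: "sources H j = {} \<Longrightarrow> closed_at H j"
  by (simp add: closed_at_def zero)

text \<open>The two blocks are disjoint, and the new hook starts at \<open>c - 1\<close>, the last
  position of the left block, from which no hook of \<open>H1\<close> can start; it also serves a
  descent there. Dominance of \<open>b\<close> makes the new hook rise and keeps every end at height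
  at most \<open>\<pi> b\<close>.\<close>

lemma hooks_on_insert_Un:
  assumes "a < c" "c \<le> b" "dominant a b" "hooks_on a c H1" "hooks_on c (Suc b) H2"
  shows "hooks_on a (Suc b) (insert (c - 1, b) (H1 \<union> H2))" (is "hooks_on _ _ ?H")
proof -
  note r1 = hooks_onD[OF assms(4)] and r2 = hooks_onD[OF assms(5)]
  have dom: "\<pi> i < \<pi> b" if "a \<le> i" "i < b" for i
    using assms(3) that by (simp add: dominant_def)
  have "a \<le> i \<and> i < j \<and> j < Suc b \<and> \<pi> i < \<pi> j" if ij: "(i, j) \<in> ?H" for i j
  proof -
    consider "i = c - 1" "j = b" | "(i, j) \<in> H1" | "(i, j) \<in> H2" using ij by auto
    then show ?thesis
    proof cases
      case 1
      moreover have "a \<le> c - 1" "c - 1 < b" using assms(1,2) by linarith+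
      ultimately show ?thesis using dom[of "c - 1"] by simp
    qed (use assms(1,2) r1[of i j] r2[of i j] in simp_all)
  qed
  moreover have "j = j'" if "(i, j) \<in> ?H" "(i, j') \<in> ?H" for i j j'
  proof -
    have "(c - 1, x) \<notin> H1 \<union> H2" for x
      using r1(2,3)[of "c - 1" x] r2(1)[of "c - 1" x] assms(1) by fastforce
    moreover have "\<not> ((i, x) \<in> H1 \<and> (i, y) \<in> H2)" for x y
      using r1[of i x] r2[of i y] by fastforce
    ultimately show ?thesis
      using that hooks_on_unique[OF assms(4), of i j j'] hooks_on_unique[OF assms(5), of i j j']
      by blast
  qed
  moreover have "\<exists>j. (i, j) \<in> ?H" if "a \<le> i" "Suc i < Suc b" "\<pi> (Suc i) < \<pi> i" for i
  proof -
    consider "Suc i < c" | "i = c - 1" | "c \<le> i" by linarith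
    then show ?thesis
      using that hooks_on_descent[OF assms(4), of i] hooks_on_descent[OF assms(5), of i]
      by cases auto
  qed
  moreover have "nested ?H"
    unfolding nested_def
  proof (intro allI impI)
    fix i j i' j'
    assume *: "(i, j) \<in> ?H" "(i', j') \<in> ?H" "\<pi> j < \<pi> j'" "i < j'" "i' < j"
    \<comment> \<open>No end is higher than \<open>\<pi> b\<close>, so the lower hook
      \<open>(i, j)\<close> cannot end at \<open>b\<close> and is not the new one. If the upper hook
      is the new one, the overlap puts \<open>(i, j)\<close> into the right block.\<close>
    have "j' \<le> b" "a \<le> j'" using *(2) r1[of i' j'] r2[of i' j'] assms(1,2) by auto
    then have "\<pi> j' \<le> \<pi> b" using dom[of j'] by (cases "j' = b") auto
    then have 1: "(i, j) \<in> H1 \<union> H2" using * by auto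
    show "i' \<le> i \<and> j \<le> j'"
    proof (cases "(i', j') = (c - 1, b)")
      case True
      then have "(i, j) \<in> H2" using 1 r1[of i j] *(5) assms(1) by auto
      then show ?thesis using True r2[of i j] by auto
    next
      case False
      then have "(i, j) \<in> H1 \<and> (i', j') \<in> H1 \<or> (i, j) \<in> H2 \<and> (i', j') \<in> H2"
        using 1 *(2,4,5) r1[of i j] r2[of i j] r1[of i' j'] r2[of i' j'] by auto
      then show ?thesis
        using * nestedD[OF hooks_on_nested] assms(4,5) by meson
    qed
  qed
  ultimately show ?thesis unfolding hooks_on_def by blast
qed

text \<open>No hook starts at \<open>c - 1\<close> here, and this is the only position whose descent
  condition is inherited from neither block. So a cut inside the interval must not be a
  descent.\<close>

lemma hooks_on_Un:
  assumes "a < c" "c \<le> b" "c < b \<longrightarrow> \<pi> (c - 1) \<le> \<pi> c" "hooks_on a c H1" "hooks_on c b H2"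
  shows "hooks_on a b (H1 \<union> H2)"
proof -
  note r1 = hooks_onD[OF assms(4)] and r2 = hooks_onD[OF assms(5)]
  have "a \<le> i \<and> i < j \<and> j < b \<and> \<pi> i < \<pi> j" if "(i, j) \<in> H1 \<union> H2" for i j
    using that assms(1,2) r1[of i j] r2[of i j] by fastforce
  moreover have "j = j'" if "(i, j) \<in> H1 \<union> H2" "(i, j') \<in> H1 \<union> H2" for i j j'
  proof -
    have "\<not> ((i, x) \<in> H1 \<and> (i, y) \<in> H2)" for x y
      using r1[of i x] r2[of i y] by fastforce
    then show ?thesis
      using that hooks_on_unique[OF assms(4), of i j j'] hooks_on_unique[OF assms(5), of i j j']
      by blast
  qed
  moreover have "\<exists>j. (i, j) \<in> H1 \<union> H2" if "a \<le> i" "Suc i < b" "\<pi> (Suc i) < \<pi> i" for i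
  proof -
    consider "Suc i < c" | "Suc i = c" | "c \<le> i" by linarith
    then show ?thesis
      using that hooks_on_descent[OF assms(4), of i] hooks_on_descent[OF assms(5), of i] assms(3)
      by cases auto
  qed
  moreover have "nested (H1 \<union> H2)"
    unfolding nested_def
  proof (intro allI impI)
    fix i j i' j'
    assume *: "(i, j) \<in> H1 \<union> H2" "(i', j') \<in> H1 \<union> H2" "\<pi> j < \<pi> j'" "i < j'" "i' < j"
    then have "(i, j) \<in> H1 \<and> (i', j') \<in> H1 \<or> (i, j) \<in> H2 \<and> (i', j') \<in> H2"
      using r1[of i j] r2[of i j] r1[of i' j'] r2[of i' j'] by auto
    then show "i' \<le> i \<and> j \<le> j'"
      using * nestedD[OF hooks_on_nested] assms(4,5) by meson
  qed
  ultimately show ?thesis unfolding hooks_on_def by blast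
qed

lemma nested_mono: "nested H \<Longrightarrow> H' \<subseteq> H \<Longrightarrow> nested H'"
  unfolding nested_def by blast

text \<open>A hook starting at \<open>c - 1\<close> may leave the block: this is the last position
  of \<open>[a, c)\<close>, where no descent condition applies. Earlier starts must keep their hooks
  inside, or a descent could lose its hook.\<close>

lemma hooks_on_left:
  assumes "hooks_on a b H" "c \<le> b" "\<And>i j. (i, j) \<in> H \<Longrightarrow> Suc i < c \<Longrightarrow> j < c"
  shows "hooks_on a c {h \<in> H. snd h < c}"
proof -
  have "\<exists>j. (i, j) \<in> H \<and> j < c" if "a \<le> i" "Suc i < c" "\<pi> (Suc i) < \<pi> i" for i
    using hooks_on_descent[OF assms(1), of i] that assms(2,3) by force
  moreover have "a \<le> i \<and> i < j \<and> j < c \<and> \<pi> i < \<pi> j"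
    if "(i, j) \<in> {h \<in> H. snd h < c}" for i j
    using that hooks_onD[OF assms(1), of i j] by simp
  moreover have "j = j'" if "(i, j) \<in> H" "(i, j') \<in> H" for i j j'
    using hooks_on_unique[OF assms(1) that] .
  moreover have "nested {h \<in> H. snd h < c}"
    by (rule nested_mono[OF hooks_on_nested[OF assms(1)]]) auto
  ultimately show ?thesis
    unfolding hooks_on_def mem_Collect_eq fst_conv snd_conv by blast
qed

lemma hooks_on_right:
  assumes "hooks_on a b H" "a \<le> c"
  shows "hooks_on c b {h \<in> H. c \<le> fst h}"
proof -
  have "\<exists>j. (i, j) \<in> H" if "c \<le> i" "Suc i < b" "\<pi> (Suc i) < \<pi> i" for i
    using hooks_on_descent[OF assms(1), of i] that assms(2) by force
  moreover have "c \<le> i \<and> i < j \<and> j < b \<and> \<pi> i < \<pi> j"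
    if "(i, j) \<in> {h \<in> H. c \<le> fst h}" for i j
    using that hooks_onD[OF assms(1), of i j] by simp
  moreover have "j = j'" if "(i, j) \<in> H" "(i, j') \<in> H" for i j j'
    using hooks_on_unique[OF assms(1) that] .
  moreover have "nested {h \<in> H. c \<le> fst h}"
    by (rule nested_mono[OF hooks_on_nested[OF assms(1)]]) auto
  ultimately show ?thesis
    unfolding hooks_on_def mem_Collect_eq fst_conv snd_conv by blast
qed

lemma insert_Un_in_partials:
  assumes c: "a < c" "c \<le> b" "c = b \<or> \<phi> c" and dom: "dominant a b"
    and H1: "H1 \<in> configs a c" and H2: "H2 \<in> partials \<phi> k c b"
  shows "insert (c - 1, b) (H1 \<union> H2) \<in> partials \<phi> (Suc k) a b" (is "?H \<in> _")
proof -
  have h1: "hooks_on a c H1" and h2: "hooks_on c (Suc b) H2"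
    using H1 H2 by (auto simp: configs_def partials_def)
  note r1 = hooks_onD[OF h1] and r2 = hooks_onD[OF h2]
  have not1: "(i, j) \<notin> H1" if "c \<le> j" for i j using r1[of i j] that by auto
  have not2: "(i, j) \<notin> H2" if "j < c \<or> i < c" for i j using r2[of i j] that by auto
  have "hooks_on a (Suc b) ?H" by (rule hooks_on_insert_Un[OF c(1,2) dom h1 h2])
  moreover have "closed_at ?H j" if "j < b" for j
  proof (cases "j < c")
    case True
    then have "sources ?H j = sources H1 j"
      using that not2 True by (auto simp: sources_def)
    moreover have "closed_at H1 j" using True H1 by (simp add: configs_def)
    ultimately show ?thesis using closed_at_cong by blast
  next
    case False
    then have "sources ?H j = sources H2 j"
      using that not1 False by (auto simp: sources_def)
    moreover have "closed_at H2 j" using that H2 by (simp add: partials_def)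
    ultimately show ?thesis using closed_at_cong by blast
  qed
  moreover have "card (sources ?H b) = Suc k"
  proof -
    have "sources ?H b = insert (c - 1) (sources H2 b)"
      using not1 c by (auto simp: sources_def)
    moreover have "c - 1 \<notin> sources H2 b"
      using not2 c by (auto simp: sources_def)
    ultimately show ?thesis
      using finite_sources[OF h2] H2 by (simp add: partials_def)
  qed
  moreover have "(b - 1, b) \<in> ?H" using H2 c by (cases "c = b") (auto simp: partials_def)
  moreover have "\<phi> (Suc i)" if "(i, b) \<in> ?H" "Suc i < b" for i
    using that not1 H2 c by (auto simp: partials_def)
  ultimately show ?thesis by (simp add: partials_def)
qed

text \<open>The hooks to \<open>b\<close> start at the last points of the blocks, so the leftmost
  start ends the first block.\<close>

definition first_cut :: "nat \<Rightarrow> hook set \<Rightarrow> nat" where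
  "first_cut b H = Suc (Min (sources H b))"

lemma first_cut_insert_Un:
  assumes "a < c" "c \<le> b" "hooks_on a c H1" "hooks_on c (Suc b) H2"
  shows "first_cut b (insert (c - 1, b) (H1 \<union> H2)) = c" (is "first_cut b ?H = c")
    and "{h \<in> insert (c - 1, b) (H1 \<union> H2). snd h < c} = H1"
    and "{h \<in> insert (c - 1, b) (H1 \<union> H2). c \<le> fst h} = H2"
proof -
  note r1 = hooks_onD[OF assms(3)] and r2 = hooks_onD[OF assms(4)]
  have not1: "(i, j) \<notin> H1" if "c \<le> j" for i j using r1[of i j] that by auto
  have "sources ?H b = insert (c - 1) (sources H2 b)"
    using not1 assms(2) by (auto simp: sources_def)
  moreover have "Min (insert (c - 1) (sources H2 b)) = c - 1"
  proof (rule Min_eqI)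
    show "c - 1 \<le> i" if "i \<in> insert (c - 1) (sources H2 b)" for i
      using that r2(1)[of i b] by (auto simp: sources_def)
  qed (use finite_sources[OF assms(4)] in auto)
  ultimately show "first_cut b ?H = c" using assms(1) by (simp add: first_cut_def)
  have "snd h < c \<and> \<not> c \<le> fst h" if "h \<in> H1" for h
    using r1[of "fst h" "snd h"] that by simp
  moreover have "c \<le> fst h \<and> \<not> snd h < c" if "h \<in> H2" for h
    using r2[of "fst h" "snd h"] that by simp
  moreover have "\<not> snd (c - 1, b) < c" "\<not> c \<le> fst (c - 1, b)"
    using assms(1,2) by simp_all
  ultimately have "h \<in> ?H \<and> snd h < c \<longleftrightarrow> h \<in> H1" "h \<in> ?H \<and> c \<le> fst h \<longleftrightarrow> h \<in> H2" for h
    unfolding insert_iff Un_iff by metis+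
  then show "{h \<in> ?H. snd h < c} = H1" "{h \<in> ?H. c \<le> fst h} = H2"
    by blast+
qed

text \<open>Apart from \<open>(c - 1, b)\<close> no hook crosses the cut. Another hook to
  \<open>b\<close> starts later because \<open>c - 1\<close> is the leftmost start. A hook ending
  before \<open>b\<close> ends lower by dominance; if it reached beyond \<open>c - 1\<close>,
  nestedness would make it start at or after \<open>c - 1\<close>, and that start is taken.\<close>

lemma partials_decompose:
  assumes dom: "dominant a b" and H: "H \<in> partials \<phi> (Suc k) a b"
  defines "c \<equiv> first_cut b H"
  shows "a < c" "c \<le> b" "c = b \<or> \<phi> c"
    and "{h \<in> H. snd h < c} \<in> configs a c" "{h \<in> H. c \<le> fst h} \<in> partials \<phi> k c b"
    and "insert (c - 1, b) ({h \<in> H. snd h < c} \<union> {h \<in> H. c \<le> fst h}) = H"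
proof -
  have h: "hooks_on a (Suc b) H" using H by (simp add: partials_def)
  note r = hooks_onD[OF h]
  have fin: "finite (sources H b)" by (rule finite_sources[OF h])
  moreover have "sources H b \<noteq> {}" using H by (auto simp: partials_def)
  ultimately have "Min (sources H b) \<in> sources H b" by simp
  then have cb: "(c - 1, b) \<in> H" by (simp add: c_def first_cut_def sources_def)
  have min: "c - 1 \<le> i" if "(i, b) \<in> H" for i
    using fin that by (simp add: c_def first_cut_def sources_def)
  have "c > 0" by (simp add: c_def first_cut_def)
  with r[OF cb] show ac: "a < c" "c \<le> b" by auto
  show cphi: "c = b \<or> \<phi> c"
    using H cb ac by (cases "c = b") (auto simp: partials_def)
  have sep: "j < c \<or> c \<le> i" if "(i, j) \<in> H" "(i, j) \<noteq> (c - 1, b)" for i j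
  proof (cases "j = b")
    case True
    then show ?thesis using min[of i] that by fastforce
  next
    case False
    then have "j < b" "a \<le> j" using r[OF that(1)] by auto
    then have "\<pi> j < \<pi> b" using dom by (simp add: dominant_def)
    then have "c - 1 < j \<Longrightarrow> c - 1 \<le> i"
      using nestedD(1)[OF hooks_on_nested[OF h] that(1) cb] \<open>j < b\<close> r[OF that(1)] by simp
    moreover have "i \<noteq> c - 1" using hooks_on_unique[OF h cb] that False by auto
    ultimately show ?thesis by linarith
  qed
  have h1: "hooks_on a c {h \<in> H. snd h < c}"
  proof (rule hooks_on_left[OF h])
    show "j < c" if "(i, j) \<in> H" "Suc i < c" for i j
      using sep[of i j] that \<open>c > 0\<close> by fastforce
  qed (use ac in simp)
  have h2: "hooks_on c (Suc b) {h \<in> H. c \<le> fst h}"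
    by (rule hooks_on_right[OF h]) (use ac in simp)
  have "closed_at {h \<in> H. snd h < c} j" if "j < c" for j
  proof -
    have "sources {h \<in> H. snd h < c} j = sources H j" using that by (auto simp: sources_def)
    moreover have "closed_at H j" using that ac H by (simp add: partials_def)
    ultimately show ?thesis using closed_at_cong by blast
  qed
  then show "{h \<in> H. snd h < c} \<in> configs a c" using h1 by (simp add: configs_def)
  have "closed_at {h \<in> H. c \<le> fst h} j" if "j < b" for j
  proof (cases "j < c")
    case True
    then have "(i, j) \<notin> H" if "c \<le> i" for i using r[of i j] that by auto
    then have "sources {h \<in> H. c \<le> fst h} j = {}" by (auto simp: sources_def)
    then show ?thesis by (rule closed_at_empty)
  next
    case False
    have "sources {h \<in> H. c \<le> fst h} j = sources H j"
      using sep[of _ j] that False by (auto simp: sources_def)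
    moreover have "closed_at H j" using that ac H by (simp add: partials_def)
    ultimately show ?thesis using closed_at_cong by blast
  qed
  moreover have "card (sources {h \<in> H. c \<le> fst h} b) = k"
  proof -
    have "sources H b = insert (c - 1) (sources {h \<in> H. c \<le> fst h} b)"
      using sep[of _ b] cb ac by (auto simp: sources_def)
    moreover have "c - 1 \<notin> sources {h \<in> H. c \<le> fst h} b"
      using \<open>c > 0\<close> by (auto simp: sources_def)
    ultimately show ?thesis
      using H finite_sources[OF h2] by (simp add: partials_def)
  qed
  ultimately show "{h \<in> H. c \<le> fst h} \<in> partials \<phi> k c b"
    using h2 H ac by (auto simp: partials_def)
  have "h = (c - 1, b) \<or> snd h < c \<or> c \<le> fst h" if "h \<in> H" for h
    using sep[of "fst h" "snd h"] that by (cases h) auto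
  then have "h \<in> insert (c - 1, b) ({h \<in> H. snd h < c} \<union> {h \<in> H. c \<le> fst h}) \<longleftrightarrow> h \<in> H" for h
    unfolding insert_iff Un_iff mem_Collect_eq using cb by metis
  then show "insert (c - 1, b) ({h \<in> H. snd h < c} \<union> {h \<in> H. c \<le> fst h}) = H"
    by (rule set_eqI)
qed

text \<open>Counterpart of \<open>bij_forests_Suc\<close>: the first tree corresponds to a
  configuration on its block, the remaining forest to a partial configuration on the rest, and the
  cut to the leftmost hook ending at \<open>b\<close>.\<close>

lemma bij_partials_Suc:
  assumes "dominant a b"
  shows "bij_betw (\<lambda>(c, H1, H2). insert (c - 1, b) (H1 \<union> H2))
    (SIGMA c:{c\<in>{a<..b}. c = b \<or> \<phi> c}. configs a c \<times> partials \<phi> k c b)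
    (partials \<phi> (Suc k) a b)"
proof (rule bij_betw_byWitness[where f' = "\<lambda>H. (first_cut b H,
    {h \<in> H. snd h < first_cut b H}, {h \<in> H. first_cut b H \<le> fst h})"])
  show "(\<lambda>(c, H1, H2). insert (c - 1, b) (H1 \<union> H2)) `
      (SIGMA c:{c\<in>{a<..b}. c = b \<or> \<phi> c}. configs a c \<times> partials \<phi> k c b)
      \<subseteq> partials \<phi> (Suc k) a b"
  proof (rule image_subsetI)
    fix x assume "x \<in> (SIGMA c:{c\<in>{a<..b}. c = b \<or> \<phi> c}. configs a c \<times> partials \<phi> k c b)"
    then obtain c H1 H2 where x: "x = (c, H1, H2)" "a < c" "c \<le> b" "c = b \<or> \<phi> c"
      "H1 \<in> configs a c" "H2 \<in> partials \<phi> k c b"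
      by auto
    show "(\<lambda>(c, H1, H2). insert (c - 1, b) (H1 \<union> H2)) x \<in> partials \<phi> (Suc k) a b"
      unfolding x(1) prod.case by (rule insert_Un_in_partials[OF x(2-4) assms x(5,6)])
  qed
  show "(\<lambda>H. (first_cut b H, {h \<in> H. snd h < first_cut b H}, {h \<in> H. first_cut b H \<le> fst h})) `
      partials \<phi> (Suc k) a b
      \<subseteq> (SIGMA c:{c\<in>{a<..b}. c = b \<or> \<phi> c}. configs a c \<times> partials \<phi> k c b)"
  proof (rule image_subsetI)
    fix H assume "H \<in> partials \<phi> (Suc k) a b"
    note d = partials_decompose[OF assms this]
    show "(first_cut b H, {h \<in> H. snd h < first_cut b H}, {h \<in> H. first_cut b H \<le> fst h})
      \<in> (SIGMA c:{c\<in>{a<..b}. c = b \<or> \<phi> c}. configs a c \<times> partials \<phi> k c b)"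
      using d(1-3) by (intro SigmaI CollectI conjI d(3-5)) simp
  qed
  show "\<forall>H\<in>partials \<phi> (Suc k) a b. (\<lambda>(c, H1, H2). insert (c - 1, b) (H1 \<union> H2))
      (first_cut b H, {h \<in> H. snd h < first_cut b H}, {h \<in> H. first_cut b H \<le> fst h}) = H"
    unfolding prod.case by (intro ballI partials_decompose(6)[OF assms])
  show "\<forall>x\<in>SIGMA c:{c\<in>{a<..b}. c = b \<or> \<phi> c}. configs a c \<times> partials \<phi> k c b.
      (\<lambda>H. (first_cut b H, {h \<in> H. snd h < first_cut b H}, {h \<in> H. first_cut b H \<le> fst h}))
        ((\<lambda>(c, H1, H2). insert (c - 1, b) (H1 \<union> H2)) x) = x"
  proof
    fix x assume "x \<in> (SIGMA c:{c\<in>{a<..b}. c = b \<or> \<phi> c}. configs a c \<times> partials \<phi> k c b)"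
    then obtain c H1 H2 where x: "x = (c, H1, H2)" "a < c" "c \<le> b"
      "hooks_on a c H1" "hooks_on c (Suc b) H2"
      unfolding configs_def partials_def by auto
    note f = first_cut_insert_Un[OF x(2-5)]
    show "(\<lambda>H. (first_cut b H, {h \<in> H. snd h < first_cut b H}, {h \<in> H. first_cut b H \<le> fst h}))
        ((\<lambda>(c, H1, H2). insert (c - 1, b) (H1 \<union> H2)) x) = x"
      unfolding x(1) prod.case f ..
  qed
qed

section \<open>Weights\<close>

text \<open>A hook covers \<open>i < x \<le> j\<close>: its start is excluded since its top part
  begins at \<open>i + 1/2\<close>. Hooks starting before \<open>a\<close> are ignored, so that one
  notion serves for color 0 on an interval and, with bounds \<open>Suc i\<close> and
  \<open>Suc j\<close>, for the color of a hook \<open>(i, j)\<close>.\<close>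

definition visible :: "hook set \<Rightarrow> nat \<Rightarrow> nat \<Rightarrow> nat set" where
  "visible H a b = {x\<in>{a..<b}. \<forall>i j. (i, j) \<in> H \<longrightarrow> a \<le> i \<longrightarrow> \<not> (i < x \<and> x \<le> j)}"

text \<open>The factors of the hook colors only. The factor of color 0 depends on the interval and
  changes under gluing, so it is kept apart.\<close>

definition weight :: "hook set \<Rightarrow> nat" where
  "weight H = (\<Prod>(i, j)\<in>H. D S (card (visible H (Suc i) (Suc j))))"

definition total :: "nat \<Rightarrow> nat \<Rightarrow> nat" where
  "total a b = (\<Sum>H\<in>configs a b. D S (card (visible H a b)) * weight H)"

section \<open>Visible sets and weights under gluing\<close>

lemma finite_visible: "finite (visible H a b)"
  by (simp add: visible_def)

text \<open>A hook covers only positions after its start, so one that starts at the last position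
  \<open>b - 1\<close> covers nothing in the interval.\<close>

lemma visible_cong:
  assumes "\<And>i j. a \<le> i \<Longrightarrow> Suc i < b \<Longrightarrow> (i, j) \<in> H \<longleftrightarrow> (i, j) \<in> H'"
  shows "visible H a b = visible H' a b"
proof -
  have "x \<in> visible H a b \<longleftrightarrow> x \<in> visible H' a b" for x
  proof (cases "x \<in> {a..<b}")
    case True
    then have "(i, j) \<in> H \<longleftrightarrow> (i, j) \<in> H'" if "a \<le> i" "i < x" for i j
      using assms[of i j] that by simp
    then show ?thesis using True unfolding visible_def by blast
  qed (auto simp: visible_def)
  then show ?thesis by blast
qed

lemma visible_first: "a < b \<Longrightarrow> a \<in> visible H a b"
  by (auto simp: visible_def)

lemma visible_empty: "visible {} a b = {a..<b}"
  by (auto simp: visible_def)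

lemma weight_empty: "weight {} = 1"
  by (simp add: weight_def)

text \<open>The factor of a hook depends only on the hooks starting strictly inside it, and these
  lie in the same block.\<close>

lemma weight_Un:
  assumes H1: "hooks_on a c H1" and H2: "hooks_on c b H2"
  shows "weight (H1 \<union> H2) = weight H1 * weight H2"
proof -
  note r1 = hooks_onD[OF H1] and r2 = hooks_onD[OF H2]
  have "(i, j) \<notin> H1 \<inter> H2" for i j
    using r1[of i j] r2[of i j] by auto
  then have "H1 \<inter> H2 = {}" by auto
  moreover have "(\<Prod>(i, j)\<in>H1. D S (card (visible (H1 \<union> H2) (Suc i) (Suc j)))) = weight H1"
    unfolding weight_def
  proof (intro prod.cong refl, clarify)
    fix i j assume *: "(i, j) \<in> H1"
    have "visible (H1 \<union> H2) (Suc i) (Suc j) = visible H1 (Suc i) (Suc j)"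
    proof (rule visible_cong)
      show "(i', j') \<in> H1 \<union> H2 \<longleftrightarrow> (i', j') \<in> H1" if "Suc i' < Suc j" for i' j'
        using that r1[OF *] r2[of i' j'] by auto
    qed
    then show "D S (card (visible (H1 \<union> H2) (Suc i) (Suc j))) = D S (card (visible H1 (Suc i) (Suc j)))"
      by simp
  qed
  moreover have "(\<Prod>(i, j)\<in>H2. D S (card (visible (H1 \<union> H2) (Suc i) (Suc j)))) = weight H2"
    unfolding weight_def
  proof (intro prod.cong refl, clarify)
    fix i j assume *: "(i, j) \<in> H2"
    have "visible (H1 \<union> H2) (Suc i) (Suc j) = visible H2 (Suc i) (Suc j)"
    proof (rule visible_cong)
      show "(i', j') \<in> H1 \<union> H2 \<longleftrightarrow> (i', j') \<in> H2" if "Suc i \<le> i'" for i' j'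
        using that r2[OF *] r1[of i' j'] by auto
    qed
    then show "D S (card (visible (H1 \<union> H2) (Suc i) (Suc j))) = D S (card (visible H2 (Suc i) (Suc j)))"
      by simp
  qed
  ultimately show ?thesis
    unfolding weight_def[of "H1 \<union> H2"]
    by (simp add: prod.union_disjoint hooks_on_finite[OF H1] hooks_on_finite[OF H2])
qed

text \<open>The points of color 0 of the right block lie under the new hook and take its color, so
  the color-0 factor of \<open>H2\<close> becomes the factor of the new hook. Other factors are
  unchanged because \<open>c - 1\<close> lies strictly inside no other hook.\<close>

lemma weight_insert_Un:
  assumes "a < c" "c \<le> b" and H1: "hooks_on a c H1" and H2: "hooks_on c (Suc b) H2"
  shows "weight (insert (c - 1, b) (H1 \<union> H2)) =
    D S (card (visible H2 c (Suc b))) * (weight H1 * weight H2)" (is "weight ?H = _")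
proof -
  note r1 = hooks_onD[OF H1] and r2 = hooks_onD[OF H2]
  have new: "(c - 1, b) \<notin> H1 \<union> H2"
    using r1(3)[of "c - 1" b] r2(1)[of "c - 1" b] assms(1,2) by auto
  have "visible ?H (Suc i) (Suc j) = visible (H1 \<union> H2) (Suc i) (Suc j)" if "(i, j) \<in> H1 \<union> H2" for i j
  proof (rule visible_cong)
    show "(i', j') \<in> ?H \<longleftrightarrow> (i', j') \<in> H1 \<union> H2" if "Suc i \<le> i'" "Suc i' < Suc j" for i' j'
    proof -
      have "i' \<noteq> c - 1"
        using that \<open>(i, j) \<in> H1 \<union> H2\<close> r1[of i j] r2[of i j] by auto
      then show ?thesis by simp
    qed
  qed
  then have "(\<Prod>(i, j)\<in>H1 \<union> H2. D S (card (visible ?H (Suc i) (Suc j)))) = weight (H1 \<union> H2)"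
    unfolding weight_def by (intro prod.cong) auto
  moreover have "visible ?H (Suc (c - 1)) (Suc b) = visible H2 c (Suc b)"
  proof -
    have "(i', j') \<notin> H1" if "c \<le> i'" for i' j' using that r1[of i' j'] by auto
    then have "visible ?H c (Suc b) = visible H2 c (Suc b)"
      using assms(1) by (intro visible_cong) auto
    then show ?thesis using assms(1) by simp
  qed
  moreover have "weight ?H = D S (card (visible ?H (Suc (c - 1)) (Suc b))) *
      (\<Prod>(i, j)\<in>H1 \<union> H2. D S (card (visible ?H (Suc i) (Suc j))))"
    unfolding weight_def using new hooks_on_finite[OF H1] hooks_on_finite[OF H2]
    by (subst prod.insert) auto
  ultimately show ?thesis using weight_Un[OF H1 H2] by simp
qed

text \<open>The new hook covers all of \<open>[c, b]\<close>, so points of color 0 remain only in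
  the left block.\<close>

lemma visible_insert_Un:
  assumes "a < c" "c \<le> b" and H1: "hooks_on a c H1" and H2: "hooks_on c (Suc b) H2"
  shows "visible (insert (c - 1, b) (H1 \<union> H2)) a (Suc b) = visible H1 a c" (is "visible ?H _ _ = _")
proof -
  have "x \<in> visible ?H a (Suc b) \<longleftrightarrow> x \<in> visible H1 a c" for x
  proof (cases "a \<le> x \<and> x < c")
    case True
    have "(i, j) \<in> ?H \<longleftrightarrow> (i, j) \<in> H1" if "i < x" for i j
      using True that hooks_onD(1)[OF H2, of i j] by auto
    then show ?thesis using True assms(2) by (auto simp: visible_def)
  next
    case False
    have "(c - 1, b) \<in> ?H" "a \<le> c - 1" using assms(1) by auto
    then have "\<not> (c - 1 < x \<and> x \<le> b)" if "x \<in> visible ?H a (Suc b)"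
      using that unfolding visible_def by blast
    moreover have "c - 1 < x \<and> x \<le> b" if "x \<in> visible ?H a (Suc b)"
    proof -
      have "a \<le> x" "x \<le> b" using that unfolding visible_def by auto
      then show ?thesis using False assms(1) by auto
    qed
    moreover have "x \<notin> visible H1 a c" using False by (auto simp: visible_def)
    ultimately show ?thesis by blast
  qed
  then show ?thesis by blast
qed

lemma visible_Un:
  assumes "a < c" "c \<le> b" and H1: "hooks_on a c H1" and H2: "hooks_on c b H2"
  shows "visible (H1 \<union> H2) a b \<inter> {..<c} = visible H1 a c"
    and "visible (H1 \<union> H2) a b \<inter> {c..} = visible H2 c b"
proof -
  note r1 = hooks_onD[OF H1] and r2 = hooks_onD[OF H2]
  have "x \<in> visible (H1 \<union> H2) a b \<and> x < c \<longleftrightarrow> x \<in> visible H1 a c" for x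
  proof (cases "x < c")
    case True
    then have "(i, j) \<in> H1 \<union> H2 \<longleftrightarrow> (i, j) \<in> H1" if "i < x" for i j
      using that r2(1)[of i j] by auto
    then show ?thesis using True assms(2) by (auto simp: visible_def)
  qed (simp add: visible_def)
  then show "visible (H1 \<union> H2) a b \<inter> {..<c} = visible H1 a c" by auto
  have "x \<in> visible (H1 \<union> H2) a b \<and> c \<le> x \<longleftrightarrow> x \<in> visible H2 c b" for x
  proof (cases "c \<le> x")
    case True
    then have "(i, j) \<in> H1 \<union> H2 \<and> a \<le> i \<longleftrightarrow> (i, j) \<in> H2 \<and> c \<le> i" if "x \<le> j" for i j
      using that r1(3)[of i j] r2(1)[of i j] assms(1) by auto
    then show ?thesis using True assms(1) unfolding visible_def by auto
  qed (simp add: visible_def)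
  then show "visible (H1 \<union> H2) a b \<inter> {c..} = visible H2 c b" by auto
qed

section \<open>Cuts of a configuration at visible positions\<close>

lemma Un_in_configs:
  assumes c: "a < c" "c \<le> b" "c = b \<or> \<pi> (c - 1) < \<pi> c"
    and H1: "H1 \<in> configs a c" and H2: "H2 \<in> configs c b"
  shows "H1 \<union> H2 \<in> configs a b"
    and "c = b \<or> c \<in> visible (H1 \<union> H2) a b"
    and "{h \<in> H1 \<union> H2. snd h < c} = H1"
    and "{h \<in> H1 \<union> H2. c \<le> fst h} = H2"
proof -
  have h1: "hooks_on a c H1" and h2: "hooks_on c b H2"
    using H1 H2 by (auto simp: configs_def)
  note r1 = hooks_onD[OF h1] and r2 = hooks_onD[OF h2]
  have not1: "(i, j) \<notin> H1" if "c \<le> j" for i j using r1[of i j] that by auto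
  have not2: "(i, j) \<notin> H2" if "j < c" for i j using r2[of i j] that by auto
  have "hooks_on a b (H1 \<union> H2)" by (rule hooks_on_Un[OF c(1,2) _ h1 h2]) (use c in auto)
  moreover have "closed_at (H1 \<union> H2) j" if "j < b" for j
  proof (cases "j < c")
    case True
    then have "sources (H1 \<union> H2) j = sources H1 j"
      using not2 by (auto simp: sources_def)
    moreover have "closed_at H1 j" using True H1 by (simp add: configs_def)
    ultimately show ?thesis using closed_at_cong by blast
  next
    case False
    then have "sources (H1 \<union> H2) j = sources H2 j"
      using not1 by (auto simp: sources_def)
    moreover have "closed_at H2 j" using that H2 by (simp add: configs_def)
    ultimately show ?thesis using closed_at_cong by blast
  qed
  ultimately show "H1 \<union> H2 \<in> configs a b" by (simp add: configs_def)
  have "c \<in> visible (H1 \<union> H2) a b" if "c \<noteq> b"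
  proof -
    have "\<not> (i < c \<and> c \<le> j)" if "(i, j) \<in> H1 \<union> H2" for i j
      using that r1[of i j] r2[of i j] by auto
    then show ?thesis using that c by (auto simp: visible_def)
  qed
  then show "c = b \<or> c \<in> visible (H1 \<union> H2) a b" by blast
  have "snd h < c \<and> \<not> c \<le> fst h" if "h \<in> H1" for h
    using r1[of "fst h" "snd h"] that by simp
  moreover have "c \<le> fst h \<and> \<not> snd h < c" if "h \<in> H2" for h
    using r2[of "fst h" "snd h"] that by simp
  ultimately have "h \<in> H1 \<union> H2 \<and> snd h < c \<longleftrightarrow> h \<in> H1" "h \<in> H1 \<union> H2 \<and> c \<le> fst h \<longleftrightarrow> h \<in> H2" for h
    unfolding Un_iff by metis+
  then show "{h \<in> H1 \<union> H2. snd h < c} = H1" "{h \<in> H1 \<union> H2. c \<le> fst h} = H2"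
    by blast+
qed

text \<open>A visible position is crossed by no hook, so both sides are configurations. It is
  reached by an ascent, since a descent at \<open>c - 1\<close> would start a hook covering
  \<open>c\<close>.\<close>

lemma configs_decompose:
  assumes H: "H \<in> configs a b" and c: "a < c" "c \<le> b" "c = b \<or> c \<in> visible H a b"
  shows "c = b \<or> \<pi> (c - 1) < \<pi> c"
    and "{h \<in> H. snd h < c} \<in> configs a c" "{h \<in> H. c \<le> fst h} \<in> configs c b"
    and "{h \<in> H. snd h < c} \<union> {h \<in> H. c \<le> fst h} = H"
proof -
  have h: "hooks_on a b H" using H by (simp add: configs_def)
  note r = hooks_onD[OF h]
  have sep: "j < c \<or> c \<le> i" if "(i, j) \<in> H" for i j
  proof (cases "c = b")
    case False
    then have "\<not> (i < c \<and> c \<le> j)" using c r(1)[OF that] that by (auto simp: visible_def)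
    then show ?thesis by linarith
  qed (use r[OF that] in simp)
  show "c = b \<or> \<pi> (c - 1) < \<pi> c"
  proof (rule ccontr)
    assume "\<not> ?thesis"
    moreover have "\<pi> (c - 1) \<noteq> \<pi> c" using inj c(1) by (simp add: inj_eq)
    ultimately have "\<pi> (Suc (c - 1)) < \<pi> (c - 1)" "c < b" using c by auto
    moreover have "a \<le> c - 1" using c(1) by linarith
    ultimately obtain j where "(c - 1, j) \<in> H"
      using hooks_on_descent[OF h, of "c - 1"] c(1) by auto
    then show False using sep[of "c - 1" j] r[of "c - 1" j] c(1) by auto
  qed
  have h1: "hooks_on a c {h \<in> H. snd h < c}"
  proof (rule hooks_on_left[OF h c(2)])
    show "j < c" if "(i, j) \<in> H" "Suc i < c" for i j
      using sep[OF that(1)] that(2) by auto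
  qed
  have h2: "hooks_on c b {h \<in> H. c \<le> fst h}"
    by (rule hooks_on_right[OF h]) (use c in simp)
  have closed: "closed_at H j" if "j < b" for j using that H by (simp add: configs_def)
  have "closed_at {h \<in> H. snd h < c} j" if "j < c" for j
  proof -
    have "sources {h \<in> H. snd h < c} j = sources H j" using that by (auto simp: sources_def)
    moreover have "closed_at H j" using closed that c by simp
    ultimately show ?thesis using closed_at_cong by blast
  qed
  then show "{h \<in> H. snd h < c} \<in> configs a c" using h1 by (simp add: configs_def)
  have "closed_at {h \<in> H. c \<le> fst h} j" if "j < b" for j
  proof (cases "j < c")
    case True
    then have "(i, j) \<notin> H" if "c \<le> i" for i using r[of i j] that by auto
    then have "sources {h \<in> H. c \<le> fst h} j = {}" by (auto simp: sources_def)
    then show ?thesis by (rule closed_at_empty)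
  next
    case False
    have "sources {h \<in> H. c \<le> fst h} j = sources H j"
      using sep[of _ j] that False by (auto simp: sources_def)
    moreover have "closed_at H j" using closed that by simp
    ultimately show ?thesis using closed_at_cong by blast
  qed
  then show "{h \<in> H. c \<le> fst h} \<in> configs c b" using h2 by (simp add: configs_def)
  have "snd h < c \<or> c \<le> fst h" if "h \<in> H" for h
    using sep[of "fst h" "snd h"] that by simp
  then show "{h \<in> H. snd h < c} \<union> {h \<in> H. c \<le> fst h} = H" by blast
qed

text \<open>Exchanges two descriptions of a cut: ascents on the tree side, visible positions on the
  hook side. The extra cut \<open>c = b\<close> stands for a first block that fills the whole
  interval.\<close>

lemma bij_configs_cut:
  "bij_betw (\<lambda>(c, H1, H2). (H1 \<union> H2, c))
    (SIGMA c:{c\<in>{a<..b}. c = b \<or> \<pi> (c - 1) < \<pi> c}. configs a c \<times> configs c b)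
    (SIGMA H:configs a b. {c\<in>{a<..b}. c = b \<or> c \<in> visible H a b})"
  (is "bij_betw ?f ?A ?B")
proof (rule bij_betw_byWitness[where f' = "\<lambda>(H, c). (c, {h \<in> H. snd h < c}, {h \<in> H. c \<le> fst h})"])
  show "?f ` ?A \<subseteq> ?B"
  proof (rule image_subsetI)
    fix x assume "x \<in> ?A"
    then obtain c H1 H2 where x: "x = (c, H1, H2)" "a < c" "c \<le> b" "c = b \<or> \<pi> (c - 1) < \<pi> c"
      "H1 \<in> configs a c" "H2 \<in> configs c b"
      by auto
    note d = Un_in_configs[OF x(2-6)]
    show "?f x \<in> ?B"
      unfolding x(1) prod.case using x(2,3) by (intro SigmaI CollectI conjI d(1,2)) simp
  qed
  show "(\<lambda>(H, c). (c, {h \<in> H. snd h < c}, {h \<in> H. c \<le> fst h})) ` ?B \<subseteq> ?A"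
  proof (rule image_subsetI)
    fix x assume "x \<in> ?B"
    then obtain H c where x: "x = (H, c)" "H \<in> configs a b" "a < c" "c \<le> b"
      "c = b \<or> c \<in> visible H a b"
      by auto
    note d = configs_decompose[OF x(2-5)]
    show "(\<lambda>(H, c). (c, {h \<in> H. snd h < c}, {h \<in> H. c \<le> fst h})) x \<in> ?A"
      unfolding x(1) prod.case using x(3,4) by (intro SigmaI CollectI conjI d(1-3)) simp
  qed
  show "\<forall>x\<in>?A. (\<lambda>(H, c). (c, {h \<in> H. snd h < c}, {h \<in> H. c \<le> fst h})) (?f x) = x"
  proof
    fix x assume "x \<in> ?A"
    then obtain c H1 H2 where x: "x = (c, H1, H2)" "a < c" "c \<le> b" "c = b \<or> \<pi> (c - 1) < \<pi> c"
      "H1 \<in> configs a c" "H2 \<in> configs c b"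
      by auto
    show "(\<lambda>(H, c). (c, {h \<in> H. snd h < c}, {h \<in> H. c \<le> fst h})) (?f x) = x"
      unfolding x(1) prod.case Un_in_configs(3,4)[OF x(2-6)] ..
  qed
  show "\<forall>x\<in>?B. ?f ((\<lambda>(H, c). (c, {h \<in> H. snd h < c}, {h \<in> H. c \<le> fst h})) x) = x"
  proof
    fix x assume "x \<in> ?B"
    then obtain H c where x: "x = (H, c)" "H \<in> configs a b" "a < c" "c \<le> b"
      "c = b \<or> c \<in> visible H a b"
      by auto
    show "?f ((\<lambda>(H, c). (c, {h \<in> H. snd h < c}, {h \<in> H. c \<le> fst h})) x) = x"
      unfolding x(1) prod.case configs_decompose(4)[OF x(2-5)] ..
  qed
qed

text \<open>As the cut runs through its range, the number of points of \<open>U\<close> to its left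
  takes each value from 1 to \<open>card U\<close> once: it increases strictly, and there are
  \<open>card U\<close> cuts. The value 0 contributes nothing because
  \<open>f 0 = 0\<close>.\<close>

lemma sum_over_cuts:
  fixes f g :: "nat \<Rightarrow> nat" and a b :: nat
  assumes U: "U \<subseteq> {a..<b}" "a < b \<Longrightarrow> a \<in> U" and "f 0 = 0" "a \<le> b"
  shows "(\<Sum>c\<in>{c\<in>{a<..b}. c = b \<or> c \<in> U}. f (card (U \<inter> {..<c})) * g (card (U \<inter> {c..})))
    = (\<Sum>j\<le>card U. f j * g (card U - j))"
proof (cases "a = b")
  case True
  then have "U = {}" "{c\<in>{a<..b}. c = b \<or> c \<in> U} = {}" using U(1) by auto
  then show ?thesis using assms(3) by simp
next
  case False
  then have ab: "a < b" "a \<in> U" using assms by auto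
  have fin: "finite U" using U(1) finite_subset by blast
  define C where "C = {c\<in>{a<..b}. c = b \<or> c \<in> U}"
  \<comment> \<open>The point \<open>a\<close> of \<open>U\<close> is not a cut, but
    \<open>b\<close> is a cut outside \<open>U\<close>, so there are again \<open>card U\<close>
    cuts.\<close>
  have C: "C = insert b (U - {a})" using U(1) ab by (force simp: C_def)
  have "b \<notin> U" using U(1) by auto
  moreover have "card U > 0" using ab fin by (auto simp: card_gt_0_iff)
  ultimately have cardC: "card C = card U"
    using ab fin by (simp add: C)
  define p where "p c = card (U \<inter> {..<c})" for c
  have less: "p c < p c'" if "c \<in> C" "c' \<in> C" "c < c'" for c c'
  proof -
    have "c \<in> U" using that U(1) by (auto simp: C_def)
    then have "U \<inter> {..<c} \<subset> U \<inter> {..<c'}" using that(3) by auto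
    then show ?thesis unfolding p_def by (intro psubset_card_mono) (simp_all add: fin)
  qed
  have inj_p: "inj_on p C"
    by (rule linorder_inj_onI) (use less in \<open>force simp: not_le\<close>)+
  have "p c \<in> {1..card U}" if "c \<in> C" for c
  proof -
    have "a \<in> U \<inter> {..<c}" using that ab by (simp add: C_def)
    then have "p c \<noteq> 0" using fin by (auto simp: p_def)
    moreover have "p c \<le> card U" unfolding p_def by (intro card_mono fin) auto
    ultimately show ?thesis by simp
  qed
  then have "p ` C \<subseteq> {1..card U}" by blast
  moreover have "card (p ` C) = card {1..card U}" using card_image[OF inj_p] cardC by simp
  ultimately have "p ` C = {1..card U}" by (intro card_subset_eq) auto
  then have bij: "bij_betw p C {1..card U}" using inj_p by (simp add: bij_betw_def)
  have rest: "card (U \<inter> {c..}) = card U - p c" for c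
  proof -
    have "U \<inter> {c..} = U - U \<inter> {..<c}" by auto
    then show ?thesis using fin by (simp add: p_def card_Diff_subset)
  qed
  have "(\<Sum>c\<in>C. f (card (U \<inter> {..<c})) * g (card (U \<inter> {c..})))
      = (\<Sum>c\<in>C. f (p c) * g (card U - p c))"
    by (simp only: rest flip: p_def)
  also have "\<dots> = (\<Sum>j\<in>{1..card U}. f j * g (card U - j))"
    by (rule sum.reindex_bij_betw[OF bij])
  also have "\<dots> = (\<Sum>j\<le>card U. f j * g (card U - j))"
  proof (rule sum.mono_neutral_left)
    show "\<forall>i\<in>{..card U} - {1..card U}. f i * g (card U - i) = 0"
    proof
      fix i assume "i \<in> {..card U} - {1..card U}"
      then have "i = 0" by auto
      then show "f i * g (card U - i) = 0" using \<open>f 0 = 0\<close> by simp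
    qed
  qed auto
  finally show ?thesis by (simp only: C_def)
qed

section \<open>Weighted sums over configurations and partial configurations\<close>

abbreviation ascent :: "nat \<Rightarrow> bool" where
  "ascent \<equiv> \<lambda>c. \<pi> (c - 1) < \<pi> c"

lemma configs_empty: "b \<le> Suc a \<Longrightarrow> configs a b = {{}}"
proof -
  assume ab: "b \<le> Suc a"
  have "H = {}" if "hooks_on a b H" for H
  proof -
    have "(i, j) \<notin> H" for i j using hooks_onD[OF that, of i j] ab by auto
    then show ?thesis by auto
  qed
  moreover have "hooks_on a b {}" using ab by (auto simp: hooks_on_def nested_def)
  moreover have "closed_at {} j" for j by (simp add: closed_at_empty sources_def)
  ultimately show ?thesis by (auto simp: configs_def)
qed

text \<open>Cuts at ascents are not marked by hooks; instead the points of color 0 are shared out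
  among \<open>k\<close> unlabeled trees. The induction splits off the first tree on both sides and
  exchanges the sums by \<open>bij_configs_cut\<close>. The assumption on \<open>total\<close> is
  the hypothesis of the main induction on subintervals.\<close>

lemma sum_configs_unit_forests:
  assumes "a \<le> b"
    and "\<And>a' c. a \<le> a' \<Longrightarrow> a' < c \<Longrightarrow> c \<le> b \<Longrightarrow> total a' c = card (trees a' c)"
  shows "(\<Sum>H\<in>configs a b. card (unit_forests S k (card (visible H a b))) * weight H)
    = splits ascent k a b"
  using assms
proof (induction k arbitrary: a)
  case 0
  show ?case
  proof (cases "a = b")
    case True
    then show ?thesis
      by (simp add: configs_empty card_unit_forests_0 visible_empty weight_empty)
  next
    case False
    then have "visible H a b \<noteq> {}" for H
      using visible_first[of a b H] 0 by auto
    then show ?thesis using False by (simp add: card_unit_forests_0 finite_visible)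
  qed
next
  case (Suc k)
  let ?C = "{c\<in>{a<..b}. c = b \<or> ascent c}"
  let ?e = "\<lambda>m. card (unit_forests S k m)"
  let ?g = "\<lambda>H c. D S (card (visible H a b \<inter> {..<c})) * ?e (card (visible H a b \<inter> {c..})) * weight H"
  have "splits ascent (Suc k) a b = (\<Sum>c\<in>?C. total a c * splits ascent k c b)"
    using Suc.prems(2) by simp
  also have "\<dots> = (\<Sum>c\<in>?C. total a c * (\<Sum>H\<in>configs c b. ?e (card (visible H c b)) * weight H))"
  proof (intro sum.cong refl)
    fix c assume c: "c \<in> ?C"
    have "(\<Sum>H\<in>configs c b. ?e (card (visible H c b)) * weight H) = splits ascent k c b"
    proof (rule Suc.IH)
      show "total a' d = card (trees a' d)" if "c \<le> a'" "a' < d" "d \<le> b" for a' d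
        using Suc.prems(2)[of a' d] that c by simp
    qed (use c in simp)
    then show "total a c * splits ascent k c b
        = total a c * (\<Sum>H\<in>configs c b. ?e (card (visible H c b)) * weight H)" by simp
  qed
  also have "\<dots> = (\<Sum>c\<in>?C. \<Sum>(H1, H2)\<in>configs a c \<times> configs c b.
      (D S (card (visible H1 a c)) * weight H1) * (?e (card (visible H2 c b)) * weight H2))"
    unfolding total_def sum_product by (simp add: sum.cartesian_product)
  also have "\<dots> = (\<Sum>(c, H1, H2)\<in>(SIGMA c:?C. configs a c \<times> configs c b).
      (D S (card (visible H1 a c)) * weight H1) * (?e (card (visible H2 c b)) * weight H2))"
    by (subst sum.Sigma) (auto simp: finite_configs split_def)
  also have "\<dots> = (\<Sum>x\<in>(SIGMA c:?C. configs a c \<times> configs c b).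
      case (\<lambda>(c, H1, H2). (H1 \<union> H2, c)) x of (H, c) \<Rightarrow> ?g H c)"
  proof (intro sum.cong refl)
    fix x assume "x \<in> (SIGMA c:?C. configs a c \<times> configs c b)"
    then obtain c H1 H2 where x: "x = (c, H1, H2)" "a < c" "c \<le> b"
      "hooks_on a c H1" "hooks_on c b H2"
      unfolding configs_def by auto
    show "(case x of (c, H1, H2) \<Rightarrow>
        (D S (card (visible H1 a c)) * weight H1) * (?e (card (visible H2 c b)) * weight H2))
      = (case (\<lambda>(c, H1, H2). (H1 \<union> H2, c)) x of (H, c) \<Rightarrow> ?g H c)"
      by (simp add: x(1) visible_Un[OF x(2-5)] weight_Un[OF x(4,5)] mult_ac)
  qed
  also have "\<dots> = (\<Sum>(H, c)\<in>(SIGMA H:configs a b. {c\<in>{a<..b}. c = b \<or> c \<in> visible H a b}). ?g H c)"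
    by (rule sum.reindex_bij_betw[OF bij_configs_cut])
  also have "\<dots> = (\<Sum>H\<in>configs a b. \<Sum>c\<in>{c\<in>{a<..b}. c = b \<or> c \<in> visible H a b}. ?g H c)"
    by (subst sum.Sigma) (auto simp: finite_configs)
  also have "\<dots> = (\<Sum>H\<in>configs a b. card (unit_forests S (Suc k) (card (visible H a b))) * weight H)"
  proof (intro sum.cong refl)
    fix H
    \<comment> \<open>For fixed \<open>H\<close> the weight does not involve the cut, and
      \<open>sum_over_cuts\<close> collapses the cuts to the convolution of
      \<open>card_unit_forests_Suc\<close>.\<close>
    have "(\<Sum>c\<in>{c\<in>{a<..b}. c = b \<or> c \<in> visible H a b}. ?g H c)
      = (\<Sum>c\<in>{c\<in>{a<..b}. c = b \<or> c \<in> visible H a b}.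
          D S (card (visible H a b \<inter> {..<c})) * ?e (card (visible H a b \<inter> {c..}))) * weight H"
      by (simp add: sum_distrib_right)
    also have "\<dots> = card (unit_forests S (Suc k) (card (visible H a b))) * weight H"
      unfolding card_unit_forests_Suc
      by (subst sum_over_cuts) (use visible_first Suc.prems(1) in \<open>auto simp: D_0 visible_def\<close>)
    finally show "(\<Sum>c\<in>{c\<in>{a<..b}. c = b \<or> c \<in> visible H a b}. ?g H c)
      = card (unit_forests S (Suc k) (card (visible H a b))) * weight H" .
  qed
  finally show ?case ..
qed

lemma partials_0:
  assumes "a \<le> b"
  shows "partials \<phi> 0 a b = (if a = b then {{}} else {})"
proof (cases "a = b")
  case True
  have "H = {}" if "hooks_on b (Suc b) H" for H
  proof -
    have "(i, j) \<notin> H" for i j using hooks_onD[OF that, of i j] by auto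
    then show ?thesis by auto
  qed
  moreover have "hooks_on b (Suc b) {}" by (auto simp: hooks_on_def nested_def)
  moreover have "closed_at {} j" for j by (simp add: closed_at_empty sources_def)
  ultimately show ?thesis using True by (auto simp: partials_def sources_def)
next
  case False
  have "b - 1 \<in> sources H b" "finite (sources H b)" if "H \<in> partials \<phi> 0 a b" for H
    using that False assms finite_sources[of a "Suc b" H b]
    by (auto simp: partials_def sources_def)
  then have "card (sources H b) \<noteq> 0" if "H \<in> partials \<phi> 0 a b" for H
    using that by auto
  then have "H \<notin> partials \<phi> 0 a b" for H
    unfolding partials_def by blast
  then show ?thesis using False by auto
qed

text \<open>Gluing turns the color-0 factor of the right part into the factor of the new hook, so
  each summand is a product of one for the first block and one for the rest, matching the recursion
  of \<open>splits\<close>.\<close>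

lemma sum_partials:
  assumes "a \<le> b" "dominant a b"
    and "\<And>a' c. a \<le> a' \<Longrightarrow> a' < c \<Longrightarrow> c \<le> b \<Longrightarrow> total a' c = card (trees a' c)"
  shows "(\<Sum>H\<in>partials \<phi> k a b. D S (card (visible H a (Suc b))) * weight H) = splits \<phi> k a b"
  using assms
proof (induction k arbitrary: a)
  case 0
  \<comment> \<open>For \<open>a = b\<close> the only visible point is \<open>b\<close>, and
    \<open>D S 1 = 1\<close> because \<open>0 \<in> S\<close>.\<close>
  then show ?case by (simp add: partials_0 visible_empty weight_empty D_1[OF zero])
next
  case (Suc k)
  let ?C = "{c\<in>{a<..b}. c = b \<or> \<phi> c}"
  let ?g = "\<lambda>H. D S (card (visible H a (Suc b))) * weight H"
  let ?h = "\<lambda>c H. D S (card (visible H c (Suc b))) * weight H"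
  have "splits \<phi> (Suc k) a b = (\<Sum>c\<in>?C. total a c * splits \<phi> k c b)"
    using Suc.prems(3) by simp
  also have "\<dots> = (\<Sum>c\<in>?C. total a c * (\<Sum>H\<in>partials \<phi> k c b. ?h c H))"
  proof (intro sum.cong refl)
    fix c assume c: "c \<in> ?C"
    have "(\<Sum>H\<in>partials \<phi> k c b. ?h c H) = splits \<phi> k c b"
    proof (rule Suc.IH)
      show "dominant c b" using Suc.prems(2) c by (auto simp: dominant_def)
      show "total a' d = card (trees a' d)" if "c \<le> a'" "a' < d" "d \<le> b" for a' d
        using Suc.prems(3)[of a' d] that c by simp
    qed (use c in simp)
    then show "total a c * splits \<phi> k c b = total a c * (\<Sum>H\<in>partials \<phi> k c b. ?h c H)"
      by simp
  qed
  also have "\<dots> = (\<Sum>c\<in>?C. \<Sum>(H1, H2)\<in>configs a c \<times> partials \<phi> k c b.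
      (D S (card (visible H1 a c)) * weight H1) * ?h c H2)"
    unfolding total_def sum_product by (simp add: sum.cartesian_product)
  also have "\<dots> = (\<Sum>(c, H1, H2)\<in>(SIGMA c:?C. configs a c \<times> partials \<phi> k c b).
      (D S (card (visible H1 a c)) * weight H1) * ?h c H2)"
    by (subst sum.Sigma) (auto simp: finite_configs finite_partials split_def)
  also have "\<dots> = (\<Sum>x\<in>(SIGMA c:?C. configs a c \<times> partials \<phi> k c b).
      ?g ((\<lambda>(c, H1, H2). insert (c - 1, b) (H1 \<union> H2)) x))"
  proof (intro sum.cong refl)
    fix x assume "x \<in> (SIGMA c:?C. configs a c \<times> partials \<phi> k c b)"
    then obtain c H1 H2 where x: "x = (c, H1, H2)" "a < c" "c \<le> b"
      "hooks_on a c H1" "hooks_on c (Suc b) H2"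
      unfolding configs_def partials_def by auto
    show "(case x of (c, H1, H2) \<Rightarrow> (D S (card (visible H1 a c)) * weight H1) * ?h c H2)
      = ?g ((\<lambda>(c, H1, H2). insert (c - 1, b) (H1 \<union> H2)) x)"
      unfolding x(1) prod.case visible_insert_Un[OF x(2-5)] weight_insert_Un[OF x(2-5)]
      by (simp only: mult_ac)
  qed
  also have "\<dots> = (\<Sum>H\<in>partials \<phi> (Suc k) a b. ?g H)"
    by (rule sum.reindex_bij_betw[OF bij_partials_Suc[OF Suc.prems(2)]])
  finally show ?case ..
qed

section \<open>Recursion on the hooks ending at the last position\<close>

lemma ex_peak:
  assumes "a \<le> b"
  shows "\<exists>m. a \<le> m \<and> m \<le> b \<and> (\<forall>i. a \<le> i \<longrightarrow> i \<le> b \<longrightarrow> \<pi> i \<le> \<pi> m)"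
proof -
  have "Max (\<pi> ` {a..b}) \<in> \<pi> ` {a..b}" using assms by (intro Max_in) auto
  then obtain m where "m \<in> {a..b}" "Max (\<pi> ` {a..b}) = \<pi> m" by auto
  moreover from this have "\<pi> i \<le> \<pi> m" if "i \<in> {a..b}" for i
    using Max_ge[of "\<pi> ` {a..b}" "\<pi> i"] that by simp
  ultimately show ?thesis by auto
qed

text \<open>The highest point of \<open>[a, b]\<close> is a descent unless it is \<open>b\<close>,
  and no hook can start there, as it would have to end higher. The tree count vanishes in the same
  case.\<close>

lemma configs_Suc_not_dominant:
  assumes "a \<le> b" "\<not> dominant a b"
  shows "configs a (Suc b) = {}"
proof -
  have False if h: "hooks_on a (Suc b) H" for H
  proof -
    obtain m where m: "a \<le> m" "m \<le> b" "\<And>i. a \<le> i \<Longrightarrow> i \<le> b \<Longrightarrow> \<pi> i \<le> \<pi> m"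
      using ex_peak[OF assms(1)] by blast
    have "m \<noteq> b"
    proof
      assume [simp]: "m = b"
      have "\<pi> i \<noteq> \<pi> b" if "i < b" for i using inj that by (simp add: inj_eq)
      then have "dominant a b" using m(3) by (auto simp: dominant_def le_neq_implies_less)
      with assms(2) show False by simp
    qed
    moreover have "\<pi> (Suc m) \<noteq> \<pi> m" using inj by (simp add: inj_eq)
    ultimately have "m < b" "\<pi> (Suc m) < \<pi> m" using m(1,2) m(3)[of "Suc m"] by auto
    then obtain j where "(m, j) \<in> H" using hooks_on_descent[OF h m(1)] by auto
    then show False using hooks_onD[OF h, of m j] m(3)[of j] by auto
  qed
  then show ?thesis unfolding configs_def by blast
qed

text \<open>Restores the descent clause of (c) at \<open>b\<close>, which \<open>partials\<close>
  omits.\<close>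

definition closed_partials :: "nat \<Rightarrow> nat \<Rightarrow> nat \<Rightarrow> hook set set" where
  "closed_partials k a b = {H\<in>partials (\<lambda>_. True) k a b. \<exists>i\<in>sources H b. \<pi> (Suc i) < \<pi> i}"

text \<open>Configurations are sorted by the number \<open>k\<close> of hooks ending at
  \<open>b\<close>. With none, the position \<open>b\<close> adds no condition because dominance
  rules out a descent at \<open>b - 1\<close> within the interval. All starts lie in
  \<open>[a, b)\<close>, which bounds \<open>k\<close>.\<close>

lemma configs_Suc:
  assumes "a \<le> b" "dominant a b"
  shows "configs a (Suc b) = configs a b \<union> (\<Union>k\<in>S \<inter> {..b - a}. closed_partials k a b)"
proof
  show "configs a (Suc b) \<subseteq> configs a b \<union> (\<Union>k\<in>S \<inter> {..b - a}. closed_partials k a b)"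
  proof
    fix H assume H: "H \<in> configs a (Suc b)"
    then have h: "hooks_on a (Suc b) H" and closed: "\<And>j. j \<le> b \<Longrightarrow> closed_at H j"
      by (auto simp: configs_def)
    note r = hooks_onD[OF h]
    show "H \<in> configs a b \<union> (\<Union>k\<in>S \<inter> {..b - a}. closed_partials k a b)"
    proof (cases "sources H b = {}")
      case True
      have "j < b" if "(i, j) \<in> H" for i j
        using r(3)[OF that] that True by (cases "j = b") (auto simp: sources_def)
      then have "hooks_on a b H"
        using h unfolding hooks_on_def by auto
      then show ?thesis using closed by (simp add: configs_def)
    next
      case False
      have "sources H b \<subseteq> {a..<b}" using r by (auto simp: sources_def)
      then have "card (sources H b) \<le> card {a..<b}" by (intro card_mono) auto
      moreover have "H \<in> closed_partials (card (sources H b)) a b"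
        using h closed closed[of b] False
        by (auto simp: closed_partials_def partials_def closed_at_def sources_def)
      moreover have "card (sources H b) \<in> S" using closed[of b] by (simp add: closed_at_def)
      ultimately show ?thesis by auto
    qed
  qed
  have "H \<in> configs a (Suc b)" if H: "H \<in> configs a b" for H
  proof -
    have h: "hooks_on a b H" using H by (simp add: configs_def)
    have "(i, b) \<notin> H" for i using hooks_onD(3)[OF h, of i b] by auto
    then have "closed_at H b" by (intro closed_at_empty) (simp add: sources_def)
    moreover have "\<exists>j. (i, j) \<in> H" if "a \<le> i" "Suc i < Suc b" "\<pi> (Suc i) < \<pi> i" for i
    proof -
      have "i \<in> {a..<b}" using that by simp
      then have "\<pi> i < \<pi> b" using assms(2) unfolding dominant_def by blast
      then have "Suc i \<noteq> b" using that by auto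
      then show ?thesis using hooks_on_descent[OF h, of i] that by simp
    qed
    then have "hooks_on a (Suc b) H"
      using h unfolding hooks_on_def by (auto intro: less_SucI)
    ultimately show ?thesis using H by (auto simp: configs_def less_Suc_eq)
  qed
  moreover have "H \<in> configs a (Suc b)" if "k \<in> S" and H: "H \<in> closed_partials k a b" for k H
  proof -
    obtain i where i: "i \<in> sources H b" "\<pi> (Suc i) < \<pi> i"
      using H by (auto simp: closed_partials_def)
    have h: "hooks_on a (Suc b) H" using H by (simp add: closed_partials_def partials_def)
    have "a < b" using hooks_onD[OF h, of i b] i(1) by (simp add: sources_def)
    then have "closed_at H b"
      using H i \<open>k \<in> S\<close> by (auto simp: closed_at_def closed_partials_def partials_def sources_def)
    then show ?thesis
      using H by (auto simp: configs_def closed_partials_def partials_def less_Suc_eq)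
  qed
  ultimately show "configs a b \<union> (\<Union>k\<in>S \<inter> {..b - a}. closed_partials k a b) \<subseteq> configs a (Suc b)"
    by blast
qed

text \<open>Having only ascents as cuts negates the descent clause, since \<open>\<pi>\<close> has
  no equal neighbors. The start \<open>b - 1\<close> is a cut for neither side and never a descent,
  as its hook rises to \<open>b\<close>.\<close>

lemma partials_ascent:
  assumes "a \<le> b" "dominant a b"
  shows "partials ascent k a b = partials (\<lambda>_. True) k a b - closed_partials k a b"
proof -
  have "(\<forall>i. (i, b) \<in> H \<longrightarrow> Suc i < b \<longrightarrow> ascent (Suc i)) \<longleftrightarrow> \<not> (\<exists>i\<in>sources H b. \<pi> (Suc i) < \<pi> i)"
    if h: "hooks_on a (Suc b) H" for H
  proof -
    have "(Suc i < b \<longrightarrow> ascent (Suc i)) \<longleftrightarrow> \<not> \<pi> (Suc i) < \<pi> i" if "(i, b) \<in> H" for i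
    proof (cases "Suc i < b")
      case True
      have "\<pi> (Suc i) \<noteq> \<pi> i" using inj by (simp add: inj_eq)
      then show ?thesis using True by auto
    next
      case False
      then have "Suc i = b" "\<pi> i < \<pi> b" using hooks_onD[OF h that] by auto
      then show ?thesis by auto
    qed
    then show ?thesis unfolding sources_def by blast
  qed
  then show ?thesis by (auto simp: partials_def closed_partials_def)
qed

text \<open>Configurations without a hook to \<open>b\<close> contribute
  \<open>splits ascent\<close>, which is also the weighted sum over the partials with ascent cuts.
  The closed partials complete these to all partials, whose weighted sum counts all forests.\<close>

lemma total_Suc:
  assumes "a \<le> b"
    and IH: "\<And>a' c. a \<le> a' \<Longrightarrow> a' < c \<Longrightarrow> c \<le> b \<Longrightarrow> total a' c = card (trees a' c)"
  shows "total a (Suc b) = card (trees a (Suc b))"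
proof (cases "dominant a b")
  case False
  then show ?thesis
    using assms(1) by (simp add: total_def configs_Suc_not_dominant card_trees_Suc)
next
  case dom: True
  let ?K = "S \<inter> {..b - a}"
  let ?g = "\<lambda>H. D S (card (visible H a (Suc b))) * weight H"
  have sub: "closed_partials k a b \<subseteq> partials (\<lambda>_. True) k a b" for k
    by (auto simp: closed_partials_def)
  have fin: "finite (closed_partials k a b)" for k
    using sub finite_partials finite_subset by blast
  have "configs a b \<inter> (\<Union>k\<in>?K. closed_partials k a b) = {}"
  proof -
    have "sources H b = {}" if "H \<in> configs a b" for H
      using that hooks_onD(3)[of a b H _ b] by (auto simp: configs_def sources_def)
    then show ?thesis by (auto simp: closed_partials_def)
  qed
  then have "total a (Suc b) = sum ?g (configs a b) + sum ?g (\<Union>k\<in>?K. closed_partials k a b)"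
    unfolding total_def configs_Suc[OF assms(1) dom]
    by (intro sum.union_disjoint) (auto simp: finite_configs fin)
  also have "sum ?g (\<Union>k\<in>?K. closed_partials k a b) = (\<Sum>k\<in>?K. sum ?g (closed_partials k a b))"
  proof (rule sum.UNION_disjoint)
    show "\<forall>i\<in>?K. \<forall>j\<in>?K. i \<noteq> j \<longrightarrow> closed_partials i a b \<inter> closed_partials j a b = {}"
      by (auto simp: closed_partials_def partials_def)
  qed (auto simp: fin)
  also have "sum ?g (configs a b) = (\<Sum>k\<in>?K. splits ascent k a b)"
  proof -
    \<comment> \<open>The point \<open>b\<close> has color 0 as well, so \<open>D\<close> is taken
      at a successor and \<open>D_Suc\<close> applies. The bound \<open>b - a\<close> does not
      depend on \<open>H\<close>, which permits swapping the sums.\<close>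
    have "?g H = (\<Sum>k\<in>?K. card (unit_forests S k (card (visible H a b))) * weight H)"
      if "H \<in> configs a b" for H
    proof -
      have h: "hooks_on a b H" using that by (simp add: configs_def)
      have "False" if "(i, j) \<in> H" "b \<le> j" for i j
        using hooks_onD(3)[OF h that(1)] that(2) by simp
      then have "x \<in> visible H a (Suc b) \<longleftrightarrow> x = b \<or> x \<in> visible H a b" for x
        using assms(1) by (auto simp: visible_def less_Suc_eq)
      then have "visible H a (Suc b) = insert b (visible H a b)" by blast
      then have "card (visible H a (Suc b)) = Suc (card (visible H a b))"
        by (simp add: finite_visible) (simp add: visible_def)
      moreover have "card (visible H a b) \<le> b - a"
      proof -
        have "visible H a b \<subseteq> {a..<b}" by (auto simp: visible_def)
        from card_mono[OF _ this] show ?thesis by simp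
      qed
      ultimately show ?thesis by (simp add: D_Suc sum_distrib_right)
    qed
    then have "sum ?g (configs a b)
        = (\<Sum>H\<in>configs a b. \<Sum>k\<in>?K. card (unit_forests S k (card (visible H a b))) * weight H)"
      by (rule sum.cong[OF refl])
    also have "\<dots> = (\<Sum>k\<in>?K. \<Sum>H\<in>configs a b. card (unit_forests S k (card (visible H a b))) * weight H)"
      by (rule sum.swap)
    also have "\<dots> = (\<Sum>k\<in>?K. splits ascent k a b)"
      by (intro sum.cong refl sum_configs_unit_forests assms)
    finally show ?thesis .
  qed
  \<comment> \<open>Read backwards for \<open>ascent\<close>, \<open>sum_partials\<close> replaces
    the splits by sums over the partials that fail the descent clause, the complement of the closed
    ones.\<close>
  also have "\<dots> + (\<Sum>k\<in>?K. sum ?g (closed_partials k a b))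
      = (\<Sum>k\<in>?K. sum ?g (partials ascent k a b) + sum ?g (closed_partials k a b))"
    unfolding sum.distrib by (simp only: sum_partials[OF assms(1) dom IH])
  also have "\<dots> = (\<Sum>k\<in>?K. sum ?g (partials (\<lambda>_. True) k a b))"
    unfolding partials_ascent[OF assms(1) dom]
    by (simp only: sum.subset_diff[OF sub finite_partials, symmetric])
  also have "\<dots> = (\<Sum>k\<in>?K. splits (\<lambda>_. True) k a b)"
    by (simp only: sum_partials[OF assms(1) dom IH])
  finally show ?thesis using dom assms(1) by (simp add: card_trees_Suc)
qed

lemma total_eq_card_trees: "a < b \<Longrightarrow> total a b = card (trees a b)"
proof (induction "b - a" arbitrary: a b rule: less_induct)
  case less
  then obtain b' where b: "b = Suc b'" "a \<le> b'" by (cases b) auto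
  show ?case
    unfolding b(1)
  proof (rule total_Suc[OF b(2)])
    show "total a' c = card (trees a' c)" if "a \<le> a'" "a' < c" "c \<le> b'" for a' c
      using less.hyps[of c a'] that b(1) by simp
  qed
qed

section \<open>Colors\<close>

text \<open>Otherwise the highest point \<open>m\<close> of \<open>[i, j]\<close> lies strictly
  inside and above \<open>\<pi> j\<close>. It is a descent, so a hook starts there; this hook ends
  higher and overlaps \<open>(i, j)\<close>, and nestedness would make it start at or before
  \<open>i\<close>.\<close>

lemma below_hook:
  assumes h: "hooks_on a b H" and ij: "(i, j) \<in> H" and k: "i \<le> k" "k < j"
  shows "\<pi> k < \<pi> j"
proof (rule ccontr)
  assume "\<not> \<pi> k < \<pi> j"
  note r = hooks_onD[OF h ij]
  obtain m where m: "i \<le> m" "m \<le> j" "\<And>x. i \<le> x \<Longrightarrow> x \<le> j \<Longrightarrow> \<pi> x \<le> \<pi> m"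
    using ex_peak[of i j] r(2) by auto
  have neq: "\<pi> x \<noteq> \<pi> y" if "x \<noteq> y" for x y using inj that by (simp add: inj_eq)
  have "\<pi> k \<noteq> \<pi> j" using neq[of k j] k by simp
  then have "\<pi> j < \<pi> m" using m(3)[of k] k \<open>\<not> \<pi> k < \<pi> j\<close> by linarith
  then have "m \<noteq> i" "m \<noteq> j" using r(4) by auto
  then have im: "i < m" "m < j" using m by auto
  then have "\<pi> (Suc m) < \<pi> m" using m(3)[of "Suc m"] neq[of "Suc m" m] by simp
  then obtain j' where j': "(m, j') \<in> H"
    using hooks_on_descent[OF h, of m] im r by auto
  have "\<pi> m < \<pi> j'" "m < j'" using hooks_onD[OF h j'] by auto
  then have "m \<le> i"
    using nestedD(1)[OF hooks_on_nested[OF h] ij j'] \<open>\<pi> j < \<pi> m\<close> im by linarith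
  then show False using im by simp
qed

end

section \<open>Sorted hook lists and sets of hooks\<close>

abbreviation sorted_hooks :: "hook list \<Rightarrow> bool" where
  "sorted_hooks \<equiv> sorted_wrt (\<lambda>h h'. sw h < sw h')"

lemma distinct_map_sw: "sorted_hooks H \<Longrightarrow> distinct (map fst H)"
  using strict_sorted_iff[of "map fst H"] by (simp add: sorted_wrt_map)

lemma bij_nth_hook:
  assumes "sorted_hooks H"
  shows "bij_betw (nth_hook H) {1..length H} (set H)"
proof -
  have "distinct H" using distinct_map_sw[OF assms] by (simp add: distinct_map)
  then have "bij_betw ((!) H) {..<length H} (set H)" by (simp add: bij_betw_nth)
  moreover have "bij_betw (\<lambda>l. l - 1) {1..length H} {..<length H}"
    by (rule bij_betw_byWitness[where f' = Suc]) auto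
  ultimately show ?thesis
    using bij_betw_trans by (fastforce simp: comp_def)
qed

lemma set_nth_hook: "sorted_hooks H \<Longrightarrow> set H = nth_hook H ` {1..length H}"
  using bij_nth_hook[of H] by (simp add: bij_betw_def)

lemma sw_nth_hook_less_iff:
  assumes "sorted_hooks H" "l \<in> {1..length H}" "l' \<in> {1..length H}"
  shows "sw (nth_hook H l) < sw (nth_hook H l') \<longleftrightarrow> l < l'"
proof -
  have *: "sw (nth_hook H l) < sw (nth_hook H l')"
    if "l < l'" "l \<in> {1..length H}" "l' \<in> {1..length H}" for l l'
    using sorted_wrt_nth_less[OF assms(1), of "l - 1" "l' - 1"] that by auto
  show ?thesis
    using *[of l l'] *[of l' l] assms(2,3) by (cases l l' rule: linorder_cases) auto
qed

lemma sorted_hooks_unique: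
  assumes "sorted_hooks H" "sorted_hooks H'" "set H = set H'"
  shows "H = H'"
proof -
  have "map fst H = map fst H'"
    using assms by (intro sorted_distinct_set_unique distinct_map_sw)
      (auto simp: sorted_wrt_map strict_sorted_imp_sorted intro: sorted_wrt_mono_rel[rotated])
  moreover have "inj_on fst (set H)"
    using distinct_map_sw[OF assms(1)] by (simp add: distinct_map)
  ultimately show ?thesis
    using assms(3) by (auto intro: map_inj_on)
qed

lemma ex_sorted_hooks:
  assumes "finite A" "inj_on fst (A :: hook set)"
  shows "\<exists>H. sorted_hooks H \<and> set H = A"
proof -
  obtain xs where xs: "set xs = A" "distinct xs" using finite_distinct_list[OF assms(1)] by blast
  let ?H = "sort_key fst xs"
  have "distinct (map fst ?H)" using xs assms(2) by (simp add: distinct_map)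
  then have "sorted_wrt (<) (map fst ?H)" by (simp add: strict_sorted_iff)
  then have "sorted_hooks ?H" by (simp add: sorted_wrt_map)
  then show ?thesis using xs by auto
qed

text \<open>The intersection runs from the larger left end to the smaller right end; these two serve
  as the distinct common points.\<close>

lemma overlap_iff:
  assumes "sw h < ne h" "sw h' < ne h'"
  shows "(\<exists>x y. x \<noteq> y \<and> {x, y} \<subseteq> hook_interval h \<inter> hook_interval h') \<longleftrightarrow> sw h < ne h' \<and> sw h' < ne h"
    (is "?L \<longleftrightarrow> ?R")
proof
  assume ?L
  then obtain x y where "x < y" "{x, y} \<subseteq> hook_interval h \<inter> hook_interval h'"
    by (metis insert_commute linorder_neqE_linordered_idom)
  then show ?R by (auto simp: hook_interval_def)
next
  assume ?R
  let ?x = "real (max (sw h) (sw h'))" and ?y = "real (min (ne h) (ne h'))"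
  have "?x \<noteq> ?y \<and> {?x, ?y} \<subseteq> hook_interval h \<inter> hook_interval h'"
    using \<open>?R\<close> assms by (auto simp: hook_interval_def)
  then show ?L by blast
qed

lemma hook_interval_subset_iff:
  "sw h < ne h \<Longrightarrow> hook_interval h \<subseteq> hook_interval h' \<longleftrightarrow> sw h' \<le> sw h \<and> ne h \<le> ne h'"
  by (auto simp: hook_interval_def)

context hook_counting
begin

section \<open>Valid hook configurations in terms of \<open>configs\<close>\<close>

lemma w_eq_card_sources:
  assumes "sorted_hooks H"
  shows "w H j = card (sources (set H) j)"
proof -
  have "inj_on (nth_hook H) {1..length H}"
    using bij_nth_hook[OF assms] by (simp only: bij_betw_def)
  then have "inj_on (nth_hook H) {l\<in>{1..length H}. ne (nth_hook H l) = j}"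
    by (rule inj_on_subset) blast
  moreover have "nth_hook H ` {l\<in>{1..length H}. ne (nth_hook H l) = j} = {h\<in>set H. ne h = j}"
    unfolding set_nth_hook[OF assms] by blast
  ultimately have "bij_betw (nth_hook H) {l\<in>{1..length H}. ne (nth_hook H l) = j} {h\<in>set H. ne h = j}"
    by (simp only: bij_betw_def)
  then have "w H j = card {h\<in>set H. ne h = j}" by (simp add: w_def bij_betw_same_card)
  also have "{h\<in>set H. ne h = j} = (\<lambda>i. (i, j)) ` sources (set H) j"
    by (auto simp: sources_def)
  finally show ?thesis by (simp add: card_image inj_on_def)
qed

text \<open>Strict sortedness supplies the uniqueness clause. The other clauses match one by one,
  where (d) is compared with \<open>nested\<close> only once all pairs are known to be hooks, as
  \<open>overlap_iff\<close> needs nondegenerate intervals.\<close>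

lemma hooks_on_set_iff:
  assumes "sorted_hooks H"
  shows "hooks_on 1 (Suc n) (set H) \<longleftrightarrow>
     (\<forall>h\<in>set H. is_hook n \<pi> h) \<and>
     (\<forall>i. descent n \<pi> i \<longrightarrow> (\<exists>h\<in>set H. sw h = i)) \<and>
     (\<forall>h\<in>set H. \<forall>h'\<in>set H.
        \<pi> (ne h) < \<pi> (ne h') \<and>
        (\<exists>x y. x \<noteq> y \<and> {x, y} \<subseteq> hook_interval h \<inter> hook_interval h') \<longrightarrow>
        hook_interval h \<subseteq> hook_interval h')"
proof -
  have unique: "j = j'" if "(i, j) \<in> set H" "(i, j') \<in> set H" for i j j'
  proof -
    have "inj_on fst (set H)" using distinct_map_sw[OF assms] by (simp add: distinct_map)
    from inj_onD[OF this _ that] show ?thesis by simp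
  qed
  have range: "(\<forall>i j. (i, j) \<in> set H \<longrightarrow> 1 \<le> i \<and> i < j \<and> j < Suc n \<and> \<pi> i < \<pi> j)
      \<longleftrightarrow> (\<forall>h\<in>set H. is_hook n \<pi> h)"
    by (fastforce simp: is_hook_def)
  have desc: "(\<forall>i. 1 \<le> i \<longrightarrow> Suc i < Suc n \<longrightarrow> \<pi> (Suc i) < \<pi> i \<longrightarrow> (\<exists>j. (i, j) \<in> set H))
      \<longleftrightarrow> (\<forall>i. descent n \<pi> i \<longrightarrow> (\<exists>h\<in>set H. sw h = i))"
  proof -
    have "descent n \<pi> i \<longleftrightarrow> 1 \<le> i \<and> Suc i < Suc n \<and> \<pi> (Suc i) < \<pi> i" for i
      by (auto simp: descent_def)
    moreover have "(\<exists>j. (i, j) \<in> set H) \<longleftrightarrow> (\<exists>h\<in>set H. sw h = i)" for i by force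
    ultimately show ?thesis by blast
  qed
  have nested: "nested (set H) \<longleftrightarrow> (\<forall>h\<in>set H. \<forall>h'\<in>set H.
        \<pi> (ne h) < \<pi> (ne h') \<and>
        (\<exists>x y. x \<noteq> y \<and> {x, y} \<subseteq> hook_interval h \<inter> hook_interval h') \<longrightarrow>
        hook_interval h \<subseteq> hook_interval h')" if hooks: "\<forall>h\<in>set H. is_hook n \<pi> h"
  proof -
    have less: "sw h < ne h" if "h \<in> set H" for h using hooks that by (simp add: is_hook_def)
    have "(\<forall>h\<in>set H. \<forall>h'\<in>set H.
        \<pi> (ne h) < \<pi> (ne h') \<and>
        (\<exists>x y. x \<noteq> y \<and> {x, y} \<subseteq> hook_interval h \<inter> hook_interval h') \<longrightarrow>
        hook_interval h \<subseteq> hook_interval h')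
      \<longleftrightarrow> (\<forall>h\<in>set H. \<forall>h'\<in>set H. \<pi> (ne h) < \<pi> (ne h') \<and> sw h < ne h' \<and> sw h' < ne h \<longrightarrow>
            sw h' \<le> sw h \<and> ne h \<le> ne h')"
      using overlap_iff[OF less less] hook_interval_subset_iff[OF less] by (intro ball_cong refl) simp
    also have "\<dots> \<longleftrightarrow> nested (set H)"
      unfolding nested_def by fastforce
    finally show ?thesis by simp
  qed
  show ?thesis
    unfolding hooks_on_def range desc using nested unique by blast
qed

lemma valid_hook_configs_iff:
  "H \<in> valid_hook_configs S n \<pi> \<longleftrightarrow> sorted_hooks H \<and> set H \<in> configs 1 (Suc n)"
proof (cases "sorted_hooks H \<and> hooks_on 1 (Suc n) (set H)")
  case True
  then have h: "hooks_on 1 (Suc n) (set H)" and sorted: "sorted_hooks H" by auto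
  \<comment> \<open>A hook starting at \<open>i\<close> ends at some \<open>j \<le> n\<close>, so
    \<open>i \<le> n - 1\<close> and the range condition in \<open>descent\<close> holds.\<close>
  have "descent n \<pi> i \<longleftrightarrow> \<pi> (Suc i) < \<pi> i" if "(i, j) \<in> set H" for i j
    using hooks_onD[OF h that] by (auto simp: descent_def)
  note desc = this
  have "(\<forall>h\<in>set H. \<exists>h'\<in>set H. \<exists>h''\<in>set H.
      descent n \<pi> (sw h') \<and> sw h'' = ne h - 1 \<and> ne h' = ne h \<and> ne h'' = ne h)
    \<longleftrightarrow> (\<forall>j. sources (set H) j \<noteq> {} \<longrightarrow>
          j - 1 \<in> sources (set H) j \<and> (\<exists>i\<in>sources (set H) j. \<pi> (Suc i) < \<pi> i))"
    (is "?L \<longleftrightarrow> ?R")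
  proof
    assume L: ?L
    show ?R
    proof (intro allI impI)
      fix j assume "sources (set H) j \<noteq> {}"
      then obtain i where "(i, j) \<in> set H" by (auto simp: sources_def)
      with L obtain h' h'' where "h' \<in> set H" "h'' \<in> set H" "descent n \<pi> (sw h')"
        "sw h'' = j - 1" "ne h' = j" "ne h'' = j"
        by fastforce
      then have *: "(sw h', j) \<in> set H" "(j - 1, j) \<in> set H" "descent n \<pi> (sw h')"
        by (metis prod.collapse)+
      then show "j - 1 \<in> sources (set H) j \<and> (\<exists>i\<in>sources (set H) j. \<pi> (Suc i) < \<pi> i)"
        using desc[OF *(1)] by (auto simp: sources_def)
    qed
  next
    assume R: ?R
    show ?L
    proof
      fix g assume "g \<in> set H"
      then have "sw g \<in> sources (set H) (ne g)" by (simp add: sources_def)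
      then obtain i where i: "(ne g - 1, ne g) \<in> set H" "(i, ne g) \<in> set H" "\<pi> (Suc i) < \<pi> i"
        using R unfolding sources_def by blast
      then have "descent n \<pi> i" using desc by blast
      with i show "\<exists>h'\<in>set H. \<exists>h''\<in>set H.
          descent n \<pi> (sw h') \<and> sw h'' = ne g - 1 \<and> ne h' = ne g \<and> ne h'' = ne g"
        by (intro bexI[of _ "(i, ne g)"] bexI[of _ "(ne g - 1, ne g)"]) auto
    qed
  qed
  also have "\<dots> \<longleftrightarrow> (\<forall>j\<in>{1..n}. sources (set H) j \<noteq> {} \<longrightarrow>
          j - 1 \<in> sources (set H) j \<and> (\<exists>i\<in>sources (set H) j. \<pi> (Suc i) < \<pi> i))"
  proof -
    have "j \<in> {1..n}" if "sources (set H) j \<noteq> {}" for j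
      using that hooks_onD[OF h, of _ j] by (force simp: sources_def)
    then show ?thesis by blast
  qed
  finally have c: "(\<forall>h\<in>set H. \<exists>h'\<in>set H. \<exists>h''\<in>set H.
      descent n \<pi> (sw h') \<and> sw h'' = ne h - 1 \<and> ne h' = ne h \<and> ne h'' = ne h)
    \<longleftrightarrow> (\<forall>j\<in>{1..n}. sources (set H) j \<noteq> {} \<longrightarrow>
          j - 1 \<in> sources (set H) j \<and> (\<exists>i\<in>sources (set H) j. \<pi> (Suc i) < \<pi> i))" .
  have "valid_hook_config n \<pi> H \<longleftrightarrow> hooks_on 1 (Suc n) (set H) \<and>
      (\<forall>h\<in>set H. \<exists>h'\<in>set H. \<exists>h''\<in>set H.
        descent n \<pi> (sw h') \<and> sw h'' = ne h - 1 \<and> ne h' = ne h \<and> ne h'' = ne h)"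
    unfolding valid_hook_config_def hooks_on_set_iff[OF sorted]
    by (intro iffI conjI; (elim conjE)?; (rule sorted | assumption))
  then have "H \<in> valid_hook_configs S n \<pi> \<longleftrightarrow> (\<forall>j\<in>{1..n}. closed_at (set H) j)"
    unfolding c valid_hook_configs_def mem_Collect_eq closed_at_def w_eq_card_sources[OF sorted]
      ball_conj_distrib
    using h by (simp only: simp_thms conj_commute)
  \<comment> \<open>The range \<open>j < Suc n\<close> includes position 0, outside the diagram. No
    hook ends there, and it is closed because \<open>0 \<in> S\<close>.\<close>
  also have "\<dots> \<longleftrightarrow> (\<forall>j<Suc n. closed_at (set H) j)"
  proof -
    have "sources (set H) 0 = {}" using hooks_onD[OF h] by (force simp: sources_def)
    then have "closed_at (set H) 0" by (rule closed_at_empty)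
    then show ?thesis by (metis atLeastAtMost_iff less_Suc_eq_le less_one not_le)
  qed
  finally show ?thesis using h sorted by (simp add: configs_def)
next
  case False
  have "sorted_hooks H \<and> hooks_on 1 (Suc n) (set H)" if "H \<in> valid_hook_configs S n \<pi>"
  proof -
    have "sorted_hooks H"
      using that unfolding valid_hook_configs_def valid_hook_config_def by blast
    then show ?thesis
      using that hooks_on_set_iff[of H n] unfolding valid_hook_configs_def valid_hook_config_def
      by blast
  qed
  then show ?thesis using False by (auto simp: configs_def)
qed

lemma bij_valid_hook_configs: "bij_betw set (valid_hook_configs S n \<pi>) (configs 1 (Suc n))"
  unfolding bij_betw_def
proof
  show "inj_on set (valid_hook_configs S n \<pi>)"
    by (rule inj_onI) (auto simp: valid_hook_configs_iff intro: sorted_hooks_unique)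
  have "A \<in> set ` valid_hook_configs S n \<pi>" if A: "A \<in> configs 1 (Suc n)" for A
  proof -
    have h: "hooks_on 1 (Suc n) A" using A by (simp add: configs_def)
    have "inj_on fst A" using hooks_on_unique[OF h] by (auto simp: inj_on_def)
    then obtain H where "sorted_hooks H" "set H = A"
      using ex_sorted_hooks hooks_on_finite[OF h] by blast
    then show ?thesis using A by (auto simp: valid_hook_configs_iff)
  qed
  then show "set ` valid_hook_configs S n \<pi> = configs 1 (Suc n)"
    by (auto simp: valid_hook_configs_iff)
qed

section \<open>Color classes as visible sets\<close>

context
  fixes n :: nat and H :: "hook list"
  assumes sorted: "sorted_hooks H" and h: "hooks_on 1 (Suc n) (set H)"
begin

lemma nth_hook_in: "l \<in> {1..length H} \<Longrightarrow> (sw (nth_hook H l), ne (nth_hook H l)) \<in> set H"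
  using nth_mem[of "l - 1" H] by auto

text \<open>Every point under a hook is at most as high as its top by \<open>below_hook\<close>, so
  the height condition holds by itself; for integers, \<open>k \<ge> i + 1/2\<close> means
  \<open>i < k\<close>.\<close>

lemma hit_eq:
  "hit \<pi> H k = {l\<in>{1..length H}. sw (nth_hook H l) < k \<and> k \<le> ne (nth_hook H l)}"
proof -
  have "real k \<in> {real i + 1/2..real j} \<longleftrightarrow> i < k \<and> k \<le> j" for i j :: nat
    by auto
  moreover have "\<pi> k \<le> \<pi> j" if "(i, j) \<in> set H" "i < k" "k \<le> j" for i j
    using below_hook[OF h that(1), of k] that by (cases "k = j") auto
  ultimately show ?thesis
    unfolding hit_def using nth_hook_in by blast
qed

lemma finite_hit: "finite (hit \<pi> H k)"
  by (simp add: hit_eq)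

text \<open>Hooks above a common point are nested, so the lowest of them is the one that starts last.\<close>

lemma hit_le:
  assumes "l \<in> hit \<pi> H k" "l' \<in> hit \<pi> H k" "\<pi> (ne (nth_hook H l)) < \<pi> (ne (nth_hook H l'))"
  shows "l' \<le> l"
proof -
  have "sw (nth_hook H l') \<le> sw (nth_hook H l)"
    using nestedD(1)[OF hooks_on_nested[OF h] nth_hook_in nth_hook_in assms(3)] assms(1,2)
    by (auto simp: hit_eq)
  then show ?thesis
    using sw_nth_hook_less_iff[OF sorted, of l l'] assms(1,2) by (auto simp: hit_eq)
qed

text \<open>Hooks are numbered by their starts, so the hook hit with the largest index starts last
  and is among the lowest. This one rule covers northeast endpoints and all other points.\<close>

lemma color_eq: "color \<pi> H k = (if hit \<pi> H k = {} then 0 else Max (hit \<pi> H k))"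
proof (cases "hit \<pi> H k = {}")
  case True
  have "ne g \<noteq> k" if g: "g \<in> set H" for g
  proof
    assume k: "ne g = k"
    obtain l where l: "l \<in> {1..length H}" "g = nth_hook H l"
      using g unfolding set_nth_hook[OF sorted] by blast
    have "sw g < ne g" using hooks_onD(2)[OF h, of "sw g" "ne g"] g by simp
    then have "l \<in> hit \<pi> H k" using l k by (simp add: hit_eq)
    then show False using True by simp
  qed
  then show ?thesis using True by (simp add: color_def)
next
  case False
  define m where "m = Max (hit \<pi> H k)"
  have m: "m \<in> hit \<pi> H k" unfolding m_def by (rule Max_in[OF finite_hit False])
  have m_max: "l \<le> m" if "l \<in> hit \<pi> H k" for l
    unfolding m_def using that finite_hit by simp
  \<comment> \<open>A hook hit strictly below hook \<open>m\<close> would have index at least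
    \<open>m\<close> by \<open>hit_le\<close>, hence would be hook \<open>m\<close> itself.\<close>
  have lowest: "\<pi> (ne (nth_hook H m)) \<le> \<pi> (ne (nth_hook H l))" if "l \<in> hit \<pi> H k" for l
    using hit_le[OF that m] m_max[OF that] by (metis le_antisym less_irrefl linorder_not_le)
  show ?thesis
  proof (cases "\<exists>g\<in>set H. ne g = k")
    case True
    then obtain g where g: "g \<in> set H" "ne g = k" by blast
    obtain l where l: "l \<in> {1..length H}" "g = nth_hook H l"
      using g unfolding set_nth_hook[OF sorted] by blast
    have "sw g < ne g" using hooks_onD(2)[OF h, of "sw g" "ne g"] g(1) by simp
    then have "l \<in> hit \<pi> H k" using l g by (simp add: hit_eq)
    \<comment> \<open>Some hook ends at \<open>k\<close>, so the lowest top is at height at most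
      \<open>\<pi> k\<close>. A hook passing beyond \<open>k\<close> would have its top above
      \<open>\<pi> k\<close>, so hook \<open>m\<close> ends at \<open>k\<close>.\<close>
    then have "\<pi> (ne (nth_hook H m)) \<le> \<pi> k" using lowest l g by fastforce
    then have "ne (nth_hook H m) = k"
      using below_hook[OF h nth_hook_in, of m k] m by (fastforce simp: hit_eq)
    then have "Max {r\<in>{1..length H}. ne (nth_hook H r) = k} = m"
    proof (intro Max_eqI)
      fix r assume r: "r \<in> {r\<in>{1..length H}. ne (nth_hook H r) = k}"
      then have "sw (nth_hook H r) < ne (nth_hook H r)"
        using hooks_onD(2)[OF h nth_hook_in] by blast
      then show "r \<le> m" using r m_max by (simp add: hit_eq)
    qed (use m in \<open>auto simp: hit_eq\<close>)
    then show ?thesis using True False by (simp add: color_def m_def)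
  next
    case no_ne: False
    have first: "m \<in> first_hit \<pi> H k" using m lowest by (simp add: first_hit_def)
    have sub: "l \<in> first_hit \<pi> H k \<Longrightarrow> l \<in> hit \<pi> H k" for l by (simp add: first_hit_def)
    have in_range: "l \<in> hit \<pi> H k \<Longrightarrow> l \<in> {1..length H}" for l by (simp add: hit_eq)
    \<comment> \<open>Starts increase strictly with the index, so the maximizer is unique.\<close>
    have "(ARG_MAX (\<lambda>l. sw (nth_hook H l)) l. l \<in> first_hit \<pi> H k) = m"
    proof (rule arg_maxI)
      show "m \<in> first_hit \<pi> H k" by (rule first)
      show "\<not> sw (nth_hook H m) < sw (nth_hook H l)" if "l \<in> first_hit \<pi> H k" for l
        using sw_nth_hook_less_iff[OF sorted in_range[OF m] in_range[OF sub[OF that]]]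
          m_max[OF sub[OF that]] by simp
      show "l = m" if l: "l \<in> first_hit \<pi> H k"
        "\<forall>y. y \<in> first_hit \<pi> H k \<longrightarrow> \<not> sw (nth_hook H l) < sw (nth_hook H y)" for l
        using sw_nth_hook_less_iff[OF sorted in_range[OF sub[OF l(1)]] in_range[OF m]]
          m_max[OF sub[OF l(1)]] l(2) first by auto
    qed
    then show ?thesis using no_ne False by (simp add: color_def m_def)
  qed
qed

lemma q_0: "q n \<pi> H 0 = card (visible (set H) 1 (Suc n))"
proof -
  \<comment> \<open>Hook indices begin at 1, so color 0 arises only as the default.\<close>
  have "color \<pi> H k = 0 \<longleftrightarrow> hit \<pi> H k = {}" for k
  proof (cases "hit \<pi> H k = {}")
    case False
    then have "Max (hit \<pi> H k) \<in> hit \<pi> H k" by (rule Max_in[OF finite_hit])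
    then have "Max (hit \<pi> H k) \<noteq> 0" by (auto simp: hit_eq)
    then show ?thesis using False by (simp add: color_eq)
  qed (simp add: color_eq)
  moreover have "hit \<pi> H k = {} \<longleftrightarrow> (\<forall>i j. (i, j) \<in> set H \<longrightarrow> 1 \<le> i \<longrightarrow> \<not> (i < k \<and> k \<le> j))" for k
  proof -
    have "hit \<pi> H k = {} \<longleftrightarrow> (\<forall>g\<in>set H. \<not> (sw g < k \<and> k \<le> ne g))"
      unfolding set_nth_hook[OF sorted] hit_eq by blast
    also have "\<dots> \<longleftrightarrow> (\<forall>i j. (i, j) \<in> set H \<longrightarrow> 1 \<le> i \<longrightarrow> \<not> (i < k \<and> k \<le> j))"
      using hooks_onD(1)[OF h] by fastforce
    finally show ?thesis .
  qed
  ultimately have "{k\<in>{1..n}. color \<pi> H k = 0} = visible (set H) 1 (Suc n)"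
    by (auto simp: visible_def)
  then show ?thesis by (simp add: q_def)
qed

text \<open>A point has color \<open>t\<close> if hook \<open>t\<close> is above it and no hook of
  larger index is. A larger index means a start farther right, which is the restriction on starts in
  \<open>visible\<close>.\<close>

lemma q_hook:
  assumes t: "t \<in> {1..length H}"
  shows "q n \<pi> H t = card (visible (set H) (Suc (sw (nth_hook H t))) (Suc (ne (nth_hook H t))))"
proof -
  have "color \<pi> H k = t \<longleftrightarrow> t \<in> hit \<pi> H k \<and> (\<forall>l\<in>hit \<pi> H k. l \<le> t)" for k
  proof (cases "hit \<pi> H k = {}")
    case False
    then show ?thesis
      using Max_eq_iff[OF finite_hit False, of t] by (auto simp: color_eq)
  qed (use t in \<open>auto simp: color_eq\<close>)
  moreover have "(\<forall>l\<in>hit \<pi> H k. l \<le> t) \<longleftrightarrow>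
      (\<forall>i j. (i, j) \<in> set H \<longrightarrow> Suc (sw (nth_hook H t)) \<le> i \<longrightarrow> \<not> (i < k \<and> k \<le> j))" for k
  proof -
    have "(\<forall>l\<in>hit \<pi> H k. l \<le> t) \<longleftrightarrow>
      (\<forall>l\<in>{1..length H}. sw (nth_hook H l) < k \<and> k \<le> ne (nth_hook H l) \<longrightarrow> \<not> t < l)"
      by (auto simp: hit_eq not_less)
    also have "\<dots> \<longleftrightarrow> (\<forall>l\<in>{1..length H}. sw (nth_hook H l) < k \<and> k \<le> ne (nth_hook H l) \<longrightarrow>
        \<not> sw (nth_hook H t) < sw (nth_hook H l))"
      using sw_nth_hook_less_iff[OF sorted t] by (intro ball_cong refl) simp
    also have "\<dots> \<longleftrightarrow> (\<forall>g\<in>set H. sw g < k \<and> k \<le> ne g \<longrightarrow> \<not> sw (nth_hook H t) < sw g)"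
      unfolding set_nth_hook[OF sorted] by blast
    also have "\<dots> \<longleftrightarrow> (\<forall>i j. (i, j) \<in> set H \<longrightarrow> Suc (sw (nth_hook H t)) \<le> i \<longrightarrow> \<not> (i < k \<and> k \<le> j))"
      by fastforce
    finally show ?thesis .
  qed
  moreover have "k \<in> {1..n} \<and> t \<in> hit \<pi> H k \<longleftrightarrow>
      k \<in> {Suc (sw (nth_hook H t))..<Suc (ne (nth_hook H t))}" for k
    using t hooks_onD(1,3)[OF h nth_hook_in[OF t]] by (auto simp: hit_eq)
  ultimately have "k \<in> {1..n} \<and> color \<pi> H k = t \<longleftrightarrow>
      k \<in> visible (set H) (Suc (sw (nth_hook H t))) (Suc (ne (nth_hook H t)))" for k
    unfolding visible_def by blast
  then have "{k\<in>{1..n}. color \<pi> H k = t}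
      = visible (set H) (Suc (sw (nth_hook H t))) (Suc (ne (nth_hook H t)))" by blast
  then show ?thesis by (simp add: q_def)
qed

lemma prod_D_q:
  "(\<Prod>t=0..length H. D S (q n \<pi> H t)) = D S (card (visible (set H) 1 (Suc n))) * weight (set H)"
proof -
  have "(\<Prod>t=0..length H. D S (q n \<pi> H t))
      = D S (q n \<pi> H 0) * (\<Prod>t\<in>{1..length H}. D S (q n \<pi> H t))"
    by (simp add: prod.atLeast_Suc_atMost)
  also have "(\<Prod>t\<in>{1..length H}. D S (q n \<pi> H t))
      = (\<Prod>t\<in>{1..length H}. (\<lambda>(i, j). D S (card (visible (set H) (Suc i) (Suc j)))) (nth_hook H t))"
    by (intro prod.cong refl) (simp only: q_hook split_def)
  also have "\<dots> = weight (set H)"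
    unfolding weight_def by (rule prod.reindex_bij_betw[OF bij_nth_hook[OF sorted]])
  finally show ?thesis by (simp only: q_0)
qed

end

lemma sum_valid_hook_configs:
  "(\<Sum>H\<in>valid_hook_configs S n \<pi>. \<Prod>t=0..length H. D S (q n \<pi> H t)) = total 1 (Suc n)"
proof -
  have "(\<Sum>H\<in>valid_hook_configs S n \<pi>. \<Prod>t=0..length H. D S (q n \<pi> H t))
    = (\<Sum>H\<in>valid_hook_configs S n \<pi>. D S (card (visible (set H) 1 (Suc n))) * weight (set H))"
    by (intro sum.cong refl prod_D_q) (auto simp: valid_hook_configs_iff configs_def)
  also have "\<dots> = total 1 (Suc n)"
    unfolding total_def by (rule sum.reindex_bij_betw[OF bij_valid_hook_configs])
  finally show ?thesis .
qed

end

theorem theorem4p1: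
  fixes n :: nat and \<pi> :: "nat \<Rightarrow> nat" and S :: "nat set"
  assumes "n \<ge> 1"
    and "\<pi> permutes {1..n}"
    and "0 \<in> S"
  shows "card {T. decreasing_S_tree S {1..n} T \<and> postorder T = map \<pi> [1..<Suc n]} =
    (\<Sum>H\<in>valid_hook_configs S n \<pi>. \<Prod>t=0..length H. D S (q n \<pi> H t))"
proof -
  \<comment> \<open>Outside \<open>{1..n}\<close> the permutation is the identity, so it is
    injective on all naturals, as the locale demands.\<close>
  interpret hook_counting \<pi> S
    by (rule hook_counting.intro[OF permutes_inj[OF assms(2)] assms(3)])
  define xs where "xs = map \<pi> [1..<Suc n]"
  have "distinct xs"
    unfolding xs_def distinct_map using permutes_inj_on[OF assms(2)] by (simp del: upt_Suc)
  moreover have "set xs = {1..n}"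
    unfolding xs_def set_map using permutes_image[OF assms(2)]
    by (simp add: atLeastLessThanSuc_atLeastAtMost del: upt_Suc)
  \<comment> \<open>The word \<open>xs\<close> has distinct letters forming \<open>{1..n}\<close>,
    so the postorder equation already gives the labeling conditions.\<close>
  ultimately have "decreasing_S_tree S {1..n} T \<and> postorder T = xs \<longleftrightarrow> T \<in> trees 1 (Suc n)" for T
    unfolding decreasing_S_tree_def trees_def xs_def[symmetric] mem_Collect_eq by blast
  then have "{T. decreasing_S_tree S {1..n} T \<and> postorder T = map \<pi> [1..<Suc n]} = trees 1 (Suc n)"
    unfolding xs_def by blast
  then show ?thesis
    using total_eq_card_trees[of 1 "Suc n"] assms(1) by (simp only: sum_valid_hook_configs)
qed

end
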